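(* Let $X$ be a connected manifold with $H_1(X,\mathbb{Z})=0$, let $F:X\to\mathbb{R}^n$ be a local diffeomorphism, and let $D\subset\mathbb{R}^n$ be a closed set for which the restriction $X-F^{-1}(D)\to\mathbb{R}^n-D$ is a $d$-sheeted covering map. If $D$ is nicely bounded by a connected $(n-1)$-submanifold $A\subset\mathbb{R}^n$ with $\mathbb{R}^n-\overline{A}$ simply connected, then $d=1$, $d=2$ or $d=\infty$.
   Context: An $(n-1)$-submanifold $A\subset\mathbb{R}^n$ nicely bounds a closed subset $D\subset\mathbb{R}^n$ (equivalently, $D$ is nicely bounded by $A$) if: (i) $D=\partial A=\overline{A}-A$; (ii) each connected component of $\overline{A}$ contains exactly one connected component of $D$; (iii) $D$ is the closure of an $(n-2)$-submanifold $D_0\subset\mathbb{R}^n$ with singular locus $\Sigma=D-D_0$ of codimension $\geq 4$ in $\mathbb{R}^n$, and $\overline{A}$ is locally diffeomorphic to a half space along $D_0$. Here $\overline{A}$ is the closure of $A$ in $\mathbb{R}^n$. Manifolds, submanifolds and local diffeomorphisms are smooth. The sheet number $d$ is a positive integer or $\infty$. *)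

theory Defs
  imports "HOL-Analysis.Analysis" "HOL-Homology.Homology"
begin

section \<open>Smooth maps and diffeomorphisms between open sets\<close>

text \<open>These notions are used only on open sets: \<open>Ck_on k f S\<close> then says that all iterated
  directional derivatives of order at most \<open>k\<close> exist and are continuous on \<open>S\<close>.\<close>

primrec Ck_on ::
  "nat \<Rightarrow> ('a::real_normed_vector \<Rightarrow> 'b::real_normed_vector) \<Rightarrow> 'a set \<Rightarrow> bool"
where
  "Ck_on 0 f S \<longleftrightarrow> continuous_on S f"
| "Ck_on (Suc k) f S \<longleftrightarrow>
     (\<forall>x\<in>S. f differentiable (at x)) \<and>
     (\<forall>v. Ck_on k (\<lambda>x. frechet_derivative f (at x) v) S)"

definition smooth_on :: "('a::real_normed_vector \<Rightarrow> 'b::real_normed_vector) \<Rightarrow> 'a set \<Rightarrow> bool"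
  where "smooth_on f S \<longleftrightarrow> (\<forall>k. Ck_on k f S)"

definition diffeomorphism ::
  "'a::real_normed_vector set \<Rightarrow> 'b::real_normed_vector set \<Rightarrow> ('a \<Rightarrow> 'b) \<Rightarrow> ('b \<Rightarrow> 'a) \<Rightarrow> bool"
where
  "diffeomorphism U V f g \<longleftrightarrow>
     open U \<and> open V \<and> homeomorphism U V f g \<and> smooth_on f U \<and> smooth_on g V"

section \<open>Smooth manifolds and local diffeomorphisms to Euclidean space\<close>

text \<open>A manifold is a subset \<open>X\<close> of a topological space, with the subspace topology (\<open>X\<close> may be
  the whole space), together with a set of charts.  A chart is a pair of its domain, open in
  \<open>X\<close>, and a map that matters only on that domain.\<close>

definition smooth_atlas ::
  "'x::topological_space set \<Rightarrow> ('x set \<times> ('x \<Rightarrow> 'm::euclidean_space)) set \<Rightarrow> bool"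
where
  "smooth_atlas X \<A> \<longleftrightarrow>
     (\<forall>(U, \<phi>)\<in>\<A>. openin (top_of_set X) U \<and> open (\<phi> ` U) \<and> (\<exists>\<psi>. homeomorphism U (\<phi> ` U) \<phi> \<psi>)) \<and>
     (\<Union>(U, \<phi>)\<in>\<A>. U) = X \<and>
     (\<forall>(U, \<phi>)\<in>\<A>. \<forall>(U', \<phi>')\<in>\<A>. smooth_on (\<phi>' \<circ> inv_into U \<phi>) (\<phi> ` (U \<inter> U')))"

definition smooth_manifold ::
  "'x::topological_space set \<Rightarrow> ('x set \<times> ('x \<Rightarrow> 'm::euclidean_space)) set \<Rightarrow> bool"
where
  "smooth_manifold X \<A> \<longleftrightarrow>
     Hausdorff_space (top_of_set X) \<and> second_countable (top_of_set X) \<and> smooth_atlas X \<A>"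

text \<open>Every point of \<open>X\<close> has an open neighbourhood \<open>U\<close> that \<open>F\<close> maps homeomorphically, with
  inverse \<open>G\<close>, onto an open set, such that \<open>F\<close> and \<open>G\<close> are smooth in all charts.\<close>

definition local_diffeomorphism ::
  "'x::topological_space set \<Rightarrow> ('x set \<times> ('x \<Rightarrow> 'm::euclidean_space)) set \<Rightarrow>
    ('x \<Rightarrow> 'b::euclidean_space) \<Rightarrow> bool"
where
  "local_diffeomorphism X \<A> F \<longleftrightarrow>
     (\<forall>p\<in>X. \<exists>U G. openin (top_of_set X) U \<and> p \<in> U \<and> open (F ` U) \<and>
        homeomorphism U (F ` U) F G \<and>
        (\<forall>(W, \<phi>)\<in>\<A>. diffeomorphism (\<phi> ` (U \<inter> W)) (F ` (U \<inter> W)) (F \<circ> inv_into W \<phi>) (\<phi> \<circ> G)))"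

section \<open>Sheet numbers\<close>

definition sheeted_covering ::
  "enat \<Rightarrow> 'a::topological_space set \<Rightarrow> ('a \<Rightarrow> 'b::topological_space) \<Rightarrow> 'b set \<Rightarrow> bool"
where
  "sheeted_covering d C p S \<longleftrightarrow>
     covering_space C p S \<and>
     (\<forall>y\<in>S. (if finite {x\<in>C. p x = y} then enat (card {x\<in>C. p x = y}) else \<infinity>) = d)"

section \<open>Submanifolds and nicely bounded sets\<close>

text \<open>Smooth embedded submanifolds of Euclidean space, without boundary and not necessarily
  closed.  They are indexed by their codimension \<open>c\<close> rather than by their dimension \<open>n - c\<close>, so
  that no truncated subtraction arises: for \<open>c > n\<close> only the empty set qualifies.\<close>

definition submanifold_codim :: "nat \<Rightarrow> (real ^ 'n) set \<Rightarrow> bool" where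
  "submanifold_codim c A \<longleftrightarrow>
     (\<forall>a\<in>A. \<exists>U V \<phi> \<psi> I. a \<in> U \<and> diffeomorphism U (V :: (real ^ 'n) set) \<phi> \<psi> \<and> card (I :: 'n set) = c \<and>
        \<phi> ` (U \<inter> A) = V \<inter> {x. \<forall>i\<in>I. x $ i = 0})"

text \<open>For an arbitrary set, codimension at least \<open>c\<close> means that it is covered by countably many
  submanifolds of codimension at least \<open>c\<close>; this includes finite and locally finite unions of
  strata, and every subset of such a union.\<close>

definition codim_at_least :: "nat \<Rightarrow> (real ^ 'n) set \<Rightarrow> bool" where
  "codim_at_least c S \<longleftrightarrow>
     (\<exists>\<M>. countable \<M> \<and> (\<forall>M\<in>\<M>. \<exists>k\<ge>c. submanifold_codim k M) \<and> S \<subseteq> \<Union>\<M>)"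

text \<open>Near each point of \<open>B\<close> there are smooth coordinates of the ambient space in which \<open>S\<close> is a
  closed half space of the hyperplane \<open>x\<^sub>i = 0\<close> and \<open>B\<close> is the boundary of that half space.\<close>

definition locally_half_space_along :: "(real ^ 'n) set \<Rightarrow> (real ^ 'n) set \<Rightarrow> bool" where
  "locally_half_space_along S B \<longleftrightarrow>
     (\<forall>b\<in>B. \<exists>U V \<phi> \<psi> i j. b \<in> U \<and> diffeomorphism U (V :: (real ^ 'n) set) \<phi> \<psi> \<and> (i :: 'n) \<noteq> j \<and>
        \<phi> ` (U \<inter> S) = V \<inter> {x. x $ i = 0 \<and> 0 \<le> x $ j} \<and>
        \<phi> ` (U \<inter> B) = V \<inter> {x. x $ i = 0 \<and> x $ j = 0})"

definition nicely_bounds :: "(real ^ 'n) set \<Rightarrow> (real ^ 'n) set \<Rightarrow> bool" where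
  "nicely_bounds A D \<longleftrightarrow>
     submanifold_codim 1 A \<and> closed D \<and>
     D = closure A - A \<and>
     (\<forall>C\<in>components (closure A). \<exists>!K. K \<in> components D \<and> K \<subseteq> C) \<and>
     (\<exists>D\<^sub>0. submanifold_codim 2 D\<^sub>0 \<and> D = closure D\<^sub>0 \<and> codim_at_least 4 (D - D\<^sub>0) \<and>
        locally_half_space_along (closure A) D\<^sub>0)"

end

theory Submission
  imports Defs
begin

text \<open>Assume that \<open>d\<close> is finite.  Put \<open>M = UNIV - D\<close>, \<open>W = X - F -` D\<close> and \<open>\<Omega> = UNIV - closure A = M - A\<close>.  Since
\<open>\<Omega>\<close> is simply connected, the covering \<open>W \<rightarrow> M\<close> is trivial over \<open>\<Omega>\<close>: its part over \<open>\<Omega>\<close> consists of \<open>d\<close>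
sheets.  Crossing the hypersurface \<open>A\<close> at a point, in a chosen direction, permutes these sheets.
Reversing the direction inverts the permutation, and moving the point along \<open>A\<close> does not change it,
so, \<open>A\<close> being connected, there is a single permutation \<open>\<tau>\<close>, well defined up to inversion
(\<open>monodromy_constant\<close>).  A set of codimension at least two does not disconnect, because almost every
line segment misses it; so \<open>W\<close> is connected, and the sheets form one orbit of \<open>\<tau>\<close>
(\<open>sheets_form_one_orbit\<close>).

If \<open>\<tau>\<close> is an involution, the orbit has at most two elements.

If \<open>F\<close> takes a value in \<open>D\<close>, it takes one in the smooth part of \<open>D\<close>, which is dense in \<open>D\<close>.
Near such a value \<open>closure A\<close> is a half hyperplane, which does not separate a ball, and a local inverse of
\<open>F\<close> identifies this ball with a set upstairs.  Its part outside \<open>closure A\<close> therefore lies in one sheet, on both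
sides of \<open>A\<close>, so \<open>\<tau>\<close> has a fixed point and \<open>d = 1\<close> (\<open>fixed_sheet\<close>, \<open>one_sheet_if_fixed\<close>).

There remains the case that \<open>F\<close> avoids \<open>D\<close> and \<open>\<tau>\<close> differs from its inverse.  Then \<open>W = X\<close>, and \<open>A\<close>
is co-oriented: of the two directions of crossing, one induces \<open>\<tau>\<close> and the other does not.
A co-orientation yields a map \<open>u\<close> from \<open>M\<close> to the punctured plane which winds once along a loop
that crosses \<open>A\<close> once (\<open>coorientation_map\<close>).  The \<open>d\<close> lifts of this loop to \<open>X\<close>
end at the points where they start, up to a permutation, so their sum is a singular cycle; \<open>u \<circ> F\<close> winds \<open>d\<close>
times along it.  But winding vanishes on boundaries (\<open>log_changes_along_cycle\<close>), and
\<open>H\<^sub>1(X) = 0\<close>, a contradiction (\<open>symmetric_if_trivial_homology\<close>).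

If \<open>A\<close> is empty, there is nothing to cross and a single sheet.  Otherwise the hypothesis on components makes
\<open>D\<close> nonempty, which the construction of \<open>u\<close> uses.\<close>

section \<open>Lifting through coverings of topological spaces\<close>

text \<open>The total space here is an arbitrary topological space, such as a subset of an abstract manifold, so
uniqueness and existence of lifts are derived from evenly covered neighbourhoods alone, without a norm,
a metric or the Hausdorff property upstairs.\<close>

definition is_lift ::
  "'a::topological_space set \<Rightarrow> ('a \<Rightarrow> 'b) \<Rightarrow> ('c \<Rightarrow> 'b) \<Rightarrow> 'c::topological_space set \<Rightarrow> ('c \<Rightarrow> 'a) \<Rightarrow> bool"
  where "is_lift C p h K g \<longleftrightarrow> continuous_on K g \<and> g ` K \<subseteq> C \<and> (\<forall>z\<in>K. p (g z) = h z)"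

text \<open>Lifts exist through every point upstairs that lies over the map.  In this form the property is
inherited by the union of two closed sets that meet in a nonempty connected set.\<close>

definition has_lifts ::
  "'a::topological_space set \<Rightarrow> ('a \<Rightarrow> 'b) \<Rightarrow> ('c \<Rightarrow> 'b) \<Rightarrow> 'c::topological_space set \<Rightarrow> bool"
  where "has_lifts C p h K \<longleftrightarrow> (\<forall>z\<in>K. \<forall>w\<in>C. p w = h z \<longrightarrow> (\<exists>g. is_lift C p h K g \<and> g z = w))"

abbreviation is_section where "is_section C p V g \<equiv> is_lift C p (\<lambda>y. y) V g"
abbreviation has_sections where "has_sections C p V \<equiv> has_lifts C p (\<lambda>y. y) V"

lemma is_lift_subset: "is_lift C p h K g \<Longrightarrow> K' \<subseteq> K \<Longrightarrow> is_lift C p h K' g"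
  unfolding is_lift_def by (meson continuous_on_subset image_mono order_trans subsetD)

lemma is_lift_compose:
  assumes "is_lift C p h K g" "continuous_on L f" "f ` L \<subseteq> K"
  shows "is_lift C p (h \<circ> f) L (g \<circ> f)"
  using assms unfolding is_lift_def
  by (auto intro: continuous_on_compose2 simp: image_subset_iff)

text \<open>Two ways of using an evenly covered neighbourhood: each point over it lies on a sheet, and the
sheets of any two points coincide or are disjoint.  The second one replaces the Hausdorff property in
the proof of uniqueness.\<close>

lemma evenly_covered:
  assumes cov: "covering_space C p S" and "y \<in> S"
  obtains T where "y \<in> T" "openin (top_of_set S) T"
    "\<And>w. w \<in> C \<Longrightarrow> p w \<in> T \<Longrightarrow> \<exists>u q. w \<in> u \<and> openin (top_of_set C) u \<and> homeomorphism u T p q"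
    "\<And>w w'. w \<in> C \<Longrightarrow> p w \<in> T \<Longrightarrow> w' \<in> C \<Longrightarrow> p w' \<in> T \<Longrightarrow>
       \<exists>u u'. w \<in> u \<and> w' \<in> u' \<and> openin (top_of_set C) u \<and> openin (top_of_set C) u' \<and>
         inj_on p u \<and> (u = u' \<or> u \<inter> u' = {})"
proof -
  define sheets where "sheets T v \<longleftrightarrow> \<Union>v = C \<inter> p -` T \<and> (\<forall>u \<in> v. openin (top_of_set C) u) \<and>
      pairwise disjnt v \<and> (\<forall>u \<in> v. \<exists>q. homeomorphism u T p q)" for T v
  have "\<forall>y\<in>S. \<exists>T. y \<in> T \<and> openin (top_of_set S) T \<and> (\<exists>v. sheets T v)"
    using cov[unfolded covering_space_def, THEN conjunct2, THEN conjunct2] unfolding sheets_def .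
  then obtain T v where T: "y \<in> T" "openin (top_of_set S) T" and sheets: "sheets T v"
    using \<open>y \<in> S\<close> by blast
  have v: "\<Union>v = C \<inter> p -` T" "\<forall>u \<in> v. openin (top_of_set C) u" "pairwise disjnt v"
      "\<forall>u \<in> v. \<exists>q. homeomorphism u T p q"
    using sheets unfolding sheets_def by simp_all
  have sheet: "\<exists>u\<in>v. w \<in> u" if "w \<in> C" "p w \<in> T" for w
  proof -
    have "w \<in> \<Union>v" unfolding v(1) using that by simp
    then show ?thesis by (rule UnionE) (rule bexI)
  qed
  have inj: "inj_on p u" if uv: "u \<in> v" for u
  proof -
    obtain q where "homeomorphism u T p q" using v(4) uv by blast
    then show ?thesis by (intro inj_on_inverseI[of _ q]) (rule homeomorphism_apply1)
  qed
  show ?thesis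
  proof (rule that[of T])
    show "\<exists>u q. w \<in> u \<and> openin (top_of_set C) u \<and> homeomorphism u T p q" if w: "w \<in> C" "p w \<in> T" for w
    proof -
      obtain u where "u \<in> v" "w \<in> u" using sheet[OF w] by blast
      moreover from v(4) this(1) have "\<exists>q. homeomorphism u T p q" by (rule bspec)
      moreover from v(2) \<open>u \<in> v\<close> have "openin (top_of_set C) u" by (rule bspec)
      ultimately show ?thesis by (auto intro!: exI[of _ u])
    qed
    show "\<exists>u u'. w \<in> u \<and> w' \<in> u' \<and> openin (top_of_set C) u \<and> openin (top_of_set C) u' \<and>
         inj_on p u \<and> (u = u' \<or> u \<inter> u' = {})"
      if w: "w \<in> C" "p w \<in> T" "w' \<in> C" "p w' \<in> T" for w w'
    proof -
      obtain u where u: "u \<in> v" "w \<in> u" using sheet[OF w(1,2)] by blast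
      obtain u' where u': "u' \<in> v" "w' \<in> u'" using sheet[OF w(3,4)] by blast
      have "u = u' \<or> u \<inter> u' = {}" using pairwiseD[OF v(3) u(1) u'(1)] by (auto simp: disjnt_def)
      moreover have "openin (top_of_set C) u" "openin (top_of_set C) u'" using v(2) u(1) u'(1) by auto
      ultimately show ?thesis using u u' inj[OF u(1)] by (intro exI[of _ u] exI[of _ u'] conjI)
    qed
  qed (use T in auto)
qed

text \<open>Where two lifts agree, they lie on the same sheet nearby and so agree nearby; where they differ,
they lie on disjoint sheets nearby.\<close>

lemma lift_unique:
  assumes cov: "covering_space C p S" and K: "connected K"
    and 1: "is_lift C p h K g1" and 2: "is_lift C p h K g2"
    and a: "a \<in> K" "g1 a = g2 a" and x: "x \<in> K"
  shows "g1 x = g2 x"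
proof (rule connected_induction_simple[OF K a(1) x, of "\<lambda>x. g1 x = g2 x"])
  fix b assume b: "b \<in> K"
  have w: "g1 b \<in> C" "g2 b \<in> C" "p (g1 b) = h b" "p (g2 b) = h b"
    using 1 2 b unfolding is_lift_def by auto
  have "h b \<in> S" using w covering_space_imp_surjective[OF cov] by (metis imageI)
  then obtain u u' where u: "g1 b \<in> u" "g2 b \<in> u'" "openin (top_of_set C) u" "openin (top_of_set C) u'"
    "inj_on p u" "u = u' \<or> u \<inter> u' = {}"
    using evenly_covered[OF cov] w by metis
  let ?T = "(K \<inter> g1 -` u) \<inter> (K \<inter> g2 -` u')"
  show "\<exists>T. openin (top_of_set K) T \<and> b \<in> T \<and> (\<forall>x\<in>T. \<forall>y\<in>T. g1 x = g2 x \<longrightarrow> g1 y = g2 y)"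
  proof (intro exI conjI ballI impI)
    have "openin (top_of_set K) (K \<inter> g1 -` u)" "openin (top_of_set K) (K \<inter> g2 -` u')"
      using 1 2 u unfolding is_lift_def
      by (auto intro!: continuous_openin_preimage[of _ _ C])
    then show "openin (top_of_set K) ?T" by blast
    show "b \<in> ?T" using b u by auto
    fix x y assume xy: "x \<in> ?T" "y \<in> ?T" "g1 x = g2 x"
    then have "u = u'" using u(6) by (metis IntE IntI empty_iff vimageE)
    moreover have "p (g1 y) = p (g2 y)" using xy 1 2 unfolding is_lift_def by auto
    ultimately show "g1 y = g2 y" using xy u(5) unfolding inj_on_def by blast
  qed
qed (use a in auto)

lemma lift_into_evenly_covered:
  assumes T: "\<And>w. w \<in> C \<Longrightarrow> p w \<in> T \<Longrightarrow> \<exists>u q. w \<in> u \<and> openin (top_of_set C) u \<and> homeomorphism u T p q"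
    and h: "continuous_on K h" "h ` K \<subseteq> T"
  shows "has_lifts C p h K"
  unfolding has_lifts_def
proof (intro ballI impI)
  fix z w assume zw: "z \<in> K" "w \<in> C" "p w = h z"
  then obtain u q where u: "w \<in> u" "openin (top_of_set C) u" "homeomorphism u T p q"
    using T h(2) by (metis image_subset_iff)
  have "is_lift C p h K (q \<circ> h)"
    unfolding is_lift_def
  proof (intro conjI ballI)
    show "continuous_on K (q \<circ> h)"
      using u(3) h unfolding homeomorphism_def by (meson continuous_on_compose continuous_on_subset)
    show "(q \<circ> h) ` K \<subseteq> C"
      using u(2,3) h(2) openin_imp_subset unfolding homeomorphism_def by fastforce
    show "p ((q \<circ> h) x) = h x" if "x \<in> K" for x
      using u(3) h(2) that by (auto simp: homeomorphism_apply2 image_subset_iff)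
  qed
  moreover have "(q \<circ> h) z = w" using u zw by (metis comp_apply homeomorphism_apply1)
  ultimately show "\<exists>g. is_lift C p h K g \<and> g z = w" by blast
qed

text \<open>A lift on one piece is continued across the intersection by the lift on the other piece that
agrees with it at one common point; uniqueness makes the two agree on the whole intersection.\<close>

lemma has_lifts_Un:
  assumes cov: "covering_space C p S"
    and K: "closed K1" "closed K2" "connected (K1 \<inter> K2)" "K1 \<inter> K2 \<noteq> {}"
    and 1: "has_lifts C p h K1" and 2: "has_lifts C p h K2"
  shows "has_lifts C p h (K1 \<union> K2)"
proof -
  have main: "\<exists>g. is_lift C p h (L1 \<union> L2) g \<and> g z = w"
    if L: "closed L1" "closed L2" "connected (L1 \<inter> L2)" "L1 \<inter> L2 \<noteq> {}"
      and lifts: "has_lifts C p h L1" "has_lifts C p h L2" and zw: "z \<in> L1" "w \<in> C" "p w = h z"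
    for L1 L2 z w
  proof -
    obtain g1 where g1: "is_lift C p h L1 g1" "g1 z = w"
      using lifts(1) zw unfolding has_lifts_def by blast
    obtain c where c: "c \<in> L1" "c \<in> L2" using L(4) by blast
    obtain g2 where g2: "is_lift C p h L2 g2" "g2 c = g1 c"
      using lifts(2) c g1(1) unfolding has_lifts_def is_lift_def by (metis image_subset_iff)
    have eq: "g1 x = g2 x" if "x \<in> L1" "x \<in> L2" for x
      by (rule lift_unique[OF cov L(3), of h _ _ c]) (use that c g1 g2 in \<open>auto intro: is_lift_subset\<close>)
    let ?g = "\<lambda>x. if x \<in> L1 then g1 x else g2 x"
    have "continuous_on (L1 \<union> L2) ?g"
      by (rule continuous_on_cases) (use L eq g1 g2 in \<open>auto simp: is_lift_def\<close>)
    then have "is_lift C p h (L1 \<union> L2) ?g"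
      using g1 g2 unfolding is_lift_def by auto
    then show ?thesis using g1(2) zw(1) by auto
  qed
  show ?thesis
    unfolding has_lifts_def
  proof (intro ballI impI)
    fix z w assume z: "z \<in> K1 \<union> K2" "w \<in> C" "p w = h z"
    have K': "connected (K2 \<inter> K1)" "K2 \<inter> K1 \<noteq> {}" using K(3,4) by (simp_all add: Int_commute)
    show "\<exists>g. is_lift C p h (K1 \<union> K2) g \<and> g z = w"
    proof (cases "z \<in> K1")
      case True
      then show ?thesis using main[OF K 1 2] z by blast
    next
      case False
      then have "\<exists>g. is_lift C p h (K2 \<union> K1) g \<and> g z = w" using main[OF K(2,1) K' 2 1] z by blast
      then show ?thesis by (simp only: Un_commute)
    qed
  qed
qed

text \<open>A compactness argument by bisection, in each coordinate in turn: small rectangles map into evenly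
covered sets, and adjacent rectangles share a segment, so lifts can be glued.\<close>

lemma has_lifts_square:
  fixes h :: "real \<times> real \<Rightarrow> 'b::topological_space"
  assumes cov: "covering_space C p S" and h: "continuous_on UNIV h" "range h \<subseteq> S"
  shows "has_lifts C p h ({0..1} \<times> {0..1})"
proof -
  have strip: "\<exists>d>0. \<forall>a b. a \<le> t \<and> t \<le> b \<and> b - a < d \<longrightarrow> has_lifts C p h ({0..1} \<times> {a..b})" for t
  proof -
    define R where "R c e \<longleftrightarrow> (\<exists>d>0. \<forall>a b. a \<le> t \<and> t \<le> b \<and> b - a < d \<longrightarrow> has_lifts C p h ({c..e} \<times> {a..b}))" for c e
    have "R 0 1"
    proof (rule Bolzano)
      fix c e f :: real assume R: "R c e" "R e f" and ce: "c \<le> e" "e \<le> f"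
      obtain d1 d2 where d: "d1 > 0" "\<And>a b. a \<le> t \<Longrightarrow> t \<le> b \<Longrightarrow> b - a < d1 \<Longrightarrow> has_lifts C p h ({c..e} \<times> {a..b})"
        "d2 > 0" "\<And>a b. a \<le> t \<Longrightarrow> t \<le> b \<Longrightarrow> b - a < d2 \<Longrightarrow> has_lifts C p h ({e..f} \<times> {a..b})"
        using R unfolding R_def by metis
      have "has_lifts C p h ({c..f} \<times> {a..b})" if ab: "a \<le> t" "t \<le> b" "b - a < min d1 d2" for a b
      proof -
        have int: "{c..e} \<times> {a..b} \<inter> {e..f} \<times> {a..b} = {e} \<times> {a..b}" using ce by auto
        have "has_lifts C p h ({c..e} \<times> {a..b} \<union> {e..f} \<times> {a..b})"
          by (rule has_lifts_Un[OF cov])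
            (use ab d in \<open>auto simp: int connected_Times intro!: closed_Times\<close>)
        moreover have "{c..e} \<times> {a..b} \<union> {e..f} \<times> {a..b} = {c..f} \<times> {a..b}" using ce by auto
        ultimately show ?thesis by simp
      qed
      then show "R c f" unfolding R_def using d by (intro exI[of _ "min d1 d2"]) auto
    next
      fix s :: real
      have "h (s,t) \<in> S" using h by auto
      then obtain T where T: "h (s,t) \<in> T" "openin (top_of_set S) T"
        "\<And>w. w \<in> C \<Longrightarrow> p w \<in> T \<Longrightarrow> \<exists>u q. w \<in> u \<and> openin (top_of_set C) u \<and> homeomorphism u T p q"
        using evenly_covered[OF cov] by metis
      have "openin (top_of_set UNIV) (UNIV \<inter> h -` T)"
        by (rule continuous_openin_preimage[of _ _ S]) (use T h in auto)
      then have "open (h -` T)" by simp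
      then obtain O1 O2 where O: "open O1" "open O2" "s \<in> O1" "t \<in> O2" "O1 \<times> O2 \<subseteq> h -` T"
        using T(1) by (metis open_prod_elim vimageI mem_Sigma_iff)
      obtain e1 e2 where e12: "e1 > 0" "ball s e1 \<subseteq> O1" "e2 > 0" "ball t e2 \<subseteq> O2"
        using O by (meson open_contains_ball)
      define e where "e = min e1 e2"
      have e: "e > 0" "ball s e \<subseteq> O1" "ball t e \<subseteq> O2"
        using e12 unfolding e_def by auto
      have "has_lifts C p h ({c..f} \<times> {a..b})"
        if "c \<le> s" "s \<le> f" "f - c < e" "a \<le> t" "t \<le> b" "b - a < e" for a b c f
      proof (rule lift_into_evenly_covered[OF T(3)])
        have "{c..f} \<times> {a..b} \<subseteq> ball s e \<times> ball t e"
          using that by (auto simp: dist_real_def)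
        then show "h ` ({c..f} \<times> {a..b}) \<subseteq> T" using O(5) e by blast
        show "continuous_on ({c..f} \<times> {a..b}) h" using h(1) continuous_on_subset by blast
      qed
      then have "R c f" if "c \<le> s" "s \<le> f" "f - c < e" for c f
        unfolding R_def using e that by blast
      then show "\<exists>d>0. \<forall>a b. a \<le> s \<and> s \<le> b \<and> b - a < d \<longrightarrow> R a b" using e by blast
    qed auto
    then show ?thesis unfolding R_def .
  qed
  show ?thesis
  proof (rule Bolzano[where P = "\<lambda>a b. has_lifts C p h ({0..1} \<times> {a..b})"])
    fix a b c :: real assume *: "has_lifts C p h ({0..1} \<times> {a..b})" "has_lifts C p h ({0..1} \<times> {b..c})"
      and ab: "a \<le> b" "b \<le> c"
    have int: "{0..1} \<times> {a..b} \<inter> {0..1} \<times> {b..c} = {0..1::real} \<times> {b}" using ab by auto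
    have "has_lifts C p h ({0..1} \<times> {a..b} \<union> {0..1} \<times> {b..c})"
      by (rule has_lifts_Un[OF cov]) (use * in \<open>auto simp: int connected_Times intro!: closed_Times\<close>)
    moreover have "{0..1} \<times> {a..b} \<union> {0..1} \<times> {b..c} = {0..1::real} \<times> {a..c}" using ab by auto
    ultimately show "has_lifts C p h ({0..1} \<times> {a..c})" by simp
  qed (use strip in auto)
qed

lemma path_lift:
  assumes cov: "covering_space C p S" and g: "path g" "path_image g \<subseteq> S" and w: "w \<in> C" "p w = g 0"
  obtains k where "is_lift C p g {0..1} k" "k 0 = w"
proof -
  \<comment> \<open>The path, as a homotopy that does not depend on the second variable, clamped so as to be defined on the plane.\<close>
  define h where "h = (\<lambda>z::real\<times>real. g (max 0 (min 1 (fst z))))"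
  have "continuous_on UNIV h" unfolding h_def
    by (rule continuous_on_compose2[of "{0..1}" g]) (use g in \<open>auto simp: path_def intro!: continuous_intros\<close>)
  moreover have "range h \<subseteq> S" using g unfolding h_def path_image_def by auto
  ultimately have "has_lifts C p h ({0..1} \<times> {0..1})" using has_lifts_square[OF cov] by blast
  moreover have "h (0,0) = p w" unfolding h_def using w by simp
  ultimately obtain k where k: "is_lift C p h ({0..1} \<times> {0..1}) k" "k (0,0) = w"
    using w(1) unfolding has_lifts_def by force
  have "is_lift C p (h \<circ> (\<lambda>t. (t,0))) {0..1} (k \<circ> (\<lambda>t. (t,0)))"
    by (rule is_lift_compose[OF k(1)]) (auto intro!: continuous_intros)
  then have "is_lift C p g {0..1} (k \<circ> (\<lambda>t. (t,0)))"
    unfolding is_lift_def h_def by auto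
  then show ?thesis using k(2) that by auto
qed

text \<open>Lift the homotopy.  On the two sides of the square where the homotopy is constant, so is its lift.\<close>

lemma monodromy_homotopic_paths:
  assumes cov: "covering_space C p S" and hom: "homotopic_paths S g1 g2"
    and k: "is_lift C p g1 {0..1} k1" "is_lift C p g2 {0..1} k2" "k1 0 = k2 0"
  shows "k1 1 = k2 1"
proof -
  obtain h0 :: "real \<times> real \<Rightarrow> 'b" where h0: "continuous_on ({0..1} \<times> {0..1}) h0"
    "h0 \<in> {0..1} \<times> {0..1} \<rightarrow> S"
    "\<And>x. x \<in> {0..1} \<Longrightarrow> h0 (0,x) = g1 x" "\<And>x. x \<in> {0..1} \<Longrightarrow> h0 (1,x) = g2 x"
    "\<And>t. t \<in> {0..1} \<Longrightarrow> h0 (t,0) = g1 0" "\<And>t. t \<in> {0..1} \<Longrightarrow> h0 (t,1) = g1 1"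
    using hom unfolding homotopic_paths by (auto simp: pathstart_def pathfinish_def)
  define h where "h = (\<lambda>z::real\<times>real. h0 (max 0 (min 1 (fst z)), max 0 (min 1 (snd z))))"
  have "continuous_on UNIV h" unfolding h_def
    by (rule continuous_on_compose2[OF h0(1)]) (auto intro!: continuous_intros)
  moreover have "range h \<subseteq> S" using h0(2) unfolding h_def by (force simp: Pi_iff)
  ultimately have "has_lifts C p h ({0..1} \<times> {0..1})" using has_lifts_square[OF cov] by blast
  moreover have "h (0,0) = p (k1 0)" "k1 0 \<in> C" using h0(3) k(1) unfolding h_def is_lift_def by auto
  ultimately obtain k where kk: "is_lift C p h ({0..1} \<times> {0..1}) k" "k (0,0) = k1 0"
    unfolding has_lifts_def by force
  have *: "is_lift C p h' {0..1} (k \<circ> f)"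
    if "continuous_on {0..1::real} f" "f ` {0..1} \<subseteq> {0..1} \<times> {0..1}" "\<And>t. t \<in> {0..1} \<Longrightarrow> h (f t) = h' t"
    for f :: "real \<Rightarrow> real \<times> real" and h'
    using is_lift_compose[OF kk(1) that(1,2)] that(3) unfolding is_lift_def by auto
  have I: "connected {0..1::real}" by simp
  have const: "is_lift C p (\<lambda>t. p w) {0..1::real} (\<lambda>t. w)" if "w \<in> C" for w
    using that unfolding is_lift_def by auto
  have left: "k (0,t) = k1 t" if "t \<in> {0..1}" for t
  proof -
    have "is_lift C p g1 {0..1} (k \<circ> Pair 0)"
      by (rule *) (use h0(3) in \<open>auto simp: h_def intro!: continuous_intros\<close>)
    from lift_unique[OF cov I this k(1), of 0] show ?thesis using kk(2) that by auto
  qed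
  have bot: "k (t,0) = k1 0" if "t \<in> {0..1}" for t
  proof -
    have "is_lift C p (\<lambda>t. p (k1 0)) {0..1} (k \<circ> (\<lambda>t. (t,0)))"
      by (rule *) (use h0(5) k(1) in \<open>auto simp: h_def is_lift_def intro!: continuous_intros\<close>)
    from lift_unique[OF cov I this const, of 0] show ?thesis using kk(2) that \<open>k1 0 \<in> C\<close> by auto
  qed
  have top: "k (t,1) = k1 1" if "t \<in> {0..1}" for t
  proof -
    have kt: "is_lift C p (\<lambda>t. p (k1 1)) {0..1} (k \<circ> (\<lambda>t. (t,1)))"
      by (rule *) (use h0(6) k(1) in \<open>auto simp: h_def is_lift_def intro!: continuous_intros\<close>)
    have "k1 1 \<in> C" using k(1) unfolding is_lift_def by auto
    then show ?thesis using lift_unique[OF cov I kt const, of 0] left[of 1] that by auto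
  qed
  have "is_lift C p g2 {0..1} (k \<circ> Pair 1)"
    by (rule *) (use h0(4) in \<open>auto simp: h_def intro!: continuous_intros\<close>)
  from lift_unique[OF cov I this k(2), of 0 1] have "k (1,1) = k2 1" using bot[of 1] k(3) by auto
  then show ?thesis using top[of 1] by auto
qed

text \<open>The value of the section at \<open>y\<close> is the end point of the lift of a path from the base point to
\<open>y\<close>.  Continuity at \<open>y\<close> comes from extending such a path by a straight segment inside a ball over which
the covering is trivial.\<close>

lemma has_sections_simply_connected:
  fixes S :: "'b::real_normed_vector set"
  assumes cov: "covering_space C p S" and T: "open T" "simply_connected T" "T \<subseteq> S"
  shows "has_sections C p T"
  unfolding has_lifts_def
proof (intro ballI impI)
  fix x0 w0 assume x0: "x0 \<in> T" and w0: "w0 \<in> C" "p w0 = x0"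
  have "\<exists>v. \<exists>g k. path g \<and> path_image g \<subseteq> T \<and> g 0 = x0 \<and> g 1 = y \<and> is_lift C p g {0..1} k \<and> k 0 = w0 \<and> k 1 = v"
    if y: "y \<in> T" for y
  proof -
    have "path_connected T" using T(2) simply_connected_imp_path_connected by blast
    then obtain g where g: "path g" "path_image g \<subseteq> T" "g 0 = x0" "g 1 = y"
      using x0 y unfolding path_connected_def pathstart_def pathfinish_def by blast
    moreover obtain k where "is_lift C p g {0..1} k" "k 0 = w0"
      using path_lift[OF cov g(1), of w0] g w0 T(3) by auto
    ultimately show ?thesis by blast
  qed
  then obtain s where s: "\<And>y. y \<in> T \<Longrightarrow> \<exists>g k. path g \<and> path_image g \<subseteq> T \<and> g 0 = x0 \<and> g 1 = y \<and>
      is_lift C p g {0..1} k \<and> k 0 = w0 \<and> k 1 = s y"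
    by metis
  have s_eq: "k 1 = s y" if "path g" "path_image g \<subseteq> T" "g 0 = x0" "g 1 = y" "is_lift C p g {0..1} k" "k 0 = w0"
    for g k y
  proof -
    have "y \<in> T" using that unfolding path_image_def by auto
    then obtain g' k' where g': "path g'" "path_image g' \<subseteq> T" "g' 0 = x0" "g' 1 = y"
      "is_lift C p g' {0..1} k'" "k' 0 = w0" "k' 1 = s y" using s by blast
    have "homotopic_paths T g g'"
      using T(2) that g' unfolding simply_connected_eq_homotopic_paths pathstart_def pathfinish_def by metis
    then have "homotopic_paths S g g'" using T(3) homotopic_paths_subset by blast
    then show ?thesis using monodromy_homotopic_paths[OF cov _ that(5) g'(5)] that g' by simp
  qed
  have "s y \<in> C \<and> p (s y) = y" if yT: "y \<in> T" for y
  proof -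
    obtain g k where "path g" "path_image g \<subseteq> T" "g 0 = x0" "g 1 = y" "is_lift C p g {0..1} k"
      "k 0 = w0" "k 1 = s y" using s[OF yT] by blast
    then show ?thesis unfolding is_lift_def by (metis atLeastAtMost_iff image_subset_iff order_refl zero_le_one)
  qed
  then have sC: "s y \<in> C" and ps: "p (s y) = y" if "y \<in> T" for y using that by auto
  have "continuous (at y within T) s" if y: "y \<in> T" for y
  proof -
    obtain U where U: "y \<in> U" "openin (top_of_set S) U"
      "\<And>w. w \<in> C \<Longrightarrow> p w \<in> U \<Longrightarrow> \<exists>u q. w \<in> u \<and> openin (top_of_set C) u \<and> homeomorphism u U p q"
      using evenly_covered[OF cov subsetD[OF T(3) y]] by metis
    obtain U' where U': "open U'" "U = S \<inter> U'" using U(2) by (auto simp: openin_open)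
    then have "U \<inter> T = U' \<inter> T" using T(3) by blast
    then have "open (U \<inter> T)" using U'(1) T(1) by auto
    then obtain e where e: "e > 0" "ball y e \<subseteq> U \<inter> T" using U(1) y open_contains_ball by blast
    have "has_sections C p (ball y e)"
      by (rule lift_into_evenly_covered[OF U(3)]) (use e in auto)
    then obtain q where q: "is_section C p (ball y e) q" "q y = s y"
      using sC[OF y] ps[OF y] e unfolding has_lifts_def by (metis centre_in_ball)
    have "s z = q z" if z: "z \<in> ball y e" for z
    proof -
      obtain g k where g: "path g" "path_image g \<subseteq> T" "g 0 = x0" "g 1 = y"
        "is_lift C p g {0..1} k" "k 0 = w0" "k 1 = s y" using s[OF y] by blast
      have seg: "closed_segment y z \<subseteq> ball y e"
        using e(1) z by (intro closed_segment_subset) auto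
      let ?l = "linepath y z"
      have ql: "path (q \<circ> ?l)" 
        by (rule path_continuous_image) (use q seg in \<open>auto simp: is_lift_def intro: continuous_on_subset\<close>)
      have gl: "pathfinish g = pathstart ?l" using g(4) by (simp add: pathfinish_def)
      have "path (g +++ ?l)" using g(1) gl by simp
      moreover have "path_image (g +++ ?l) \<subseteq> T" using g(2) seg e(2) gl by (auto simp: path_image_join)
      moreover have "(g +++ ?l) 0 = x0" "(g +++ ?l) 1 = z"
        using g by (auto simp: joinpaths_def linepath_def)
      ultimately have 1: "path (g +++ ?l)" "path_image (g +++ ?l) \<subseteq> T" "(g +++ ?l) 0 = x0" "(g +++ ?l) 1 = z"
        by auto
      have "path (k +++ (q \<circ> ?l))"
        using g(5,7) ql q(2) by (subst path_join) (auto simp: pathfinish_def pathstart_def is_lift_def path_def linepath_def)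
      then have "is_lift C p (g +++ ?l) {0..1} (k +++ (q \<circ> ?l))"
        unfolding is_lift_def
      proof (intro conjI ballI)
        have lin: "?l t \<in> ball y e" if "t \<in> {0..1}" for t
          using seg that by (metis linepath_in_path subsetD)
        show "continuous_on {0..1} (k +++ (q \<circ> ?l))" using \<open>path (k +++ (q \<circ> ?l))\<close> path_def by blast
        have "p ((k +++ (q \<circ> ?l)) t) = (g +++ ?l) t \<and> (k +++ (q \<circ> ?l)) t \<in> C" if "t \<in> {0..1}" for t
        proof (cases "t \<le> 1/2")
          case True
          then show ?thesis using g(5) that by (auto simp: is_lift_def joinpaths_def)
        next
          case False
          then have "?l (2*t-1) \<in> ball y e" using that by (intro lin) auto
          then show ?thesis using False q(1) by (auto simp: is_lift_def joinpaths_def)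
        qed
        then show "(k +++ (q \<circ> ?l)) ` {0..1} \<subseteq> C" "\<And>t. t \<in> {0..1} \<Longrightarrow> p ((k +++ (q \<circ> ?l)) t) = (g +++ ?l) t"
          by auto
      qed
      from s_eq[OF 1 this] show ?thesis using g(6) by (auto simp: joinpaths_def linepath_def)
    qed
    moreover have "continuous (at y within T) q"
    proof -
      have "continuous (at y) q" using q(1) e(1) unfolding is_lift_def
        by (metis centre_in_ball continuous_on_eq_continuous_at open_ball)
      then show ?thesis by (rule continuous_at_imp_continuous_at_within)
    qed
    moreover have "dist z y < e \<Longrightarrow> z \<in> ball y e" for z by (simp add: dist_commute)
    ultimately show ?thesis
      by (metis continuous_transform_within e(1) y)
  qed
  then have "continuous_on T s" by (simp add: continuous_on_eq_continuous_within)
  moreover have "s x0 = w0"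
  proof -
    have "is_lift C p (\<lambda>t. x0) {0..1} (\<lambda>t. w0)" using w0 by (auto simp: is_lift_def)
    moreover have "path (\<lambda>t::real. x0)" "path_image (\<lambda>t::real. x0) \<subseteq> T"
      using x0 by (auto simp: path_def path_image_def)
    ultimately have "w0 = s x0" using s_eq[OF _ _ refl refl _ refl] by blast
    then show ?thesis by simp
  qed
  ultimately show "\<exists>g. is_section C p T g \<and> g x0 = w0"
    using sC ps unfolding is_lift_def by (intro exI[of _ s]) auto
qed

section \<open>Winding is zero on cycles that bound\<close>

text \<open>The change of a continuous logarithm along a path in the punctured plane, that is \<open>2\<pi>i\<close> times the
winding number if the path is closed; the value is arbitrary if there is no continuous logarithm.\<close>

definition log_change :: "(real \<Rightarrow> complex) \<Rightarrow> complex" where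
  "log_change h = (SOME r. \<exists>g. continuous_on {0..1} g \<and> (\<forall>t\<in>{0..1}. exp (g t) = h t) \<and> r = g 1 - g 0)"

lemma log_change_eq:
  assumes "continuous_on {0..1} g" "\<And>t. t \<in> {0..1} \<Longrightarrow> exp (g t) = h t"
  shows "log_change h = g 1 - g 0"
  unfolding log_change_def
proof (rule some_equality)
  show "\<exists>g'. continuous_on {0..1} g' \<and> (\<forall>t\<in>{0..1}. exp (g' t) = h t) \<and> g 1 - g 0 = g' 1 - g' 0"
    using assms by blast
  fix r assume "\<exists>g'. continuous_on {0..1} g' \<and> (\<forall>t\<in>{0..1}. exp (g' t) = h t) \<and> r = g' 1 - g' 0"
  then obtain g' where g': "continuous_on {0..1} g'" "\<And>t. t \<in> {0..1} \<Longrightarrow> exp (g' t) = h t" "r = g' 1 - g' 0"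
    by blast
  have "exp (g 0 - g' 0) = 1"
    using assms(2)[of 0] g'(2)[of 0] exp_not_eq_zero[of "g 0"] by (simp add: exp_diff)
  then have 1: "is_lift UNIV exp h {0..1} (\<lambda>t. g' t + (g 0 - g' 0))"
    unfolding is_lift_def by (auto simp: g' exp_add intro!: continuous_intros)
  have 2: "is_lift UNIV exp h {0..1} g" unfolding is_lift_def using assms by auto
  have "g 1 = g' 1 + (g 0 - g' 0)"
    by (rule lift_unique[OF covering_space_exp_punctured_plane _ 2 1, of 0]) auto
  then show "r = g 1 - g 0" using g'(3) by simp
qed

text \<open>Parametrisations of the standard simplices of dimensions one and two by an interval and a plane triangle,
where continuous logarithms on subsets of normed spaces are at hand.\<close>

definition edge :: "real \<Rightarrow> nat \<Rightarrow> real" where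
  "edge t = (\<lambda>i. if i = 0 then 1 - t else if i = 1 then t else 0)"

definition triangle :: "real \<times> real \<Rightarrow> nat \<Rightarrow> real" where
  "triangle z = (\<lambda>i. if i = 0 then 1 - fst z - snd z else if i = 1 then fst z else if i = 2 then snd z else 0)"

definition linear_extension :: "('s \<Rightarrow> complex) \<Rightarrow> ('s \<Rightarrow>\<^sub>0 int) \<Rightarrow> complex" where
  "linear_extension \<phi> c = (\<Sum>s\<in>Poly_Mapping.keys c. of_int (Poly_Mapping.lookup c s) * \<phi> s)"

lemma linear_extension_superset:
  assumes "finite K" "Poly_Mapping.keys c \<subseteq> K"
  shows "linear_extension \<phi> c = (\<Sum>s\<in>K. of_int (Poly_Mapping.lookup c s) * \<phi> s)"
  unfolding linear_extension_def
  by (rule sum.mono_neutral_left) (use assms in \<open>auto simp: in_keys_iff\<close>)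

lemma linear_extension_0 [simp]: "linear_extension \<phi> 0 = 0"
  by (simp add: linear_extension_def)

lemma linear_extension_of [simp]: "linear_extension \<phi> (frag_of s) = \<phi> s"
  by (simp add: linear_extension_def)

lemma linear_extension_diff: "linear_extension \<phi> (a - b) = linear_extension \<phi> a - linear_extension \<phi> b"
proof -
  let ?K = "Poly_Mapping.keys a \<union> Poly_Mapping.keys b"
  have "linear_extension \<phi> c = (\<Sum>s\<in>?K. of_int (Poly_Mapping.lookup c s) * \<phi> s)"
    if "c \<in> {a, b, a - b}" for c
    by (rule linear_extension_superset) (use that keys_diff[of a b] in auto)
  then show ?thesis
    by (simp add: lookup_minus left_diff_distrib sum_subtractf)
qed

lemma linear_extension_minus: "linear_extension \<phi> (- a) = - linear_extension \<phi> a"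
  using linear_extension_diff[of \<phi> 0 a] by simp

lemma linear_extension_add: "linear_extension \<phi> (a + b) = linear_extension \<phi> a + linear_extension \<phi> b"
  using linear_extension_diff[of \<phi> a "- b"] linear_extension_minus[of \<phi> b] by simp

lemma linear_extension_sum: "finite I \<Longrightarrow> linear_extension \<phi> (\<Sum>i\<in>I. a i) = (\<Sum>i\<in>I. linear_extension \<phi> (a i))"
  by (induction I rule: finite_induct) (simp_all add: linear_extension_add)

lemma sum_upto_2: "(\<Sum>k\<le>(2::nat). f k) = f 0 + f 1 + (f 2 :: 'a::comm_monoid_add)"
  by (simp add: numeral_2_eq_2)

lemma edge_in_simplex: "t \<in> {0..1} \<Longrightarrow> edge t \<in> standard_simplex 1"
  unfolding edge_def standard_simplex_def by auto

lemma triangle_in_simplex: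
  "0 \<le> fst z \<Longrightarrow> 0 \<le> snd z \<Longrightarrow> fst z + snd z \<le> 1 \<Longrightarrow> triangle z \<in> standard_simplex 2"
  unfolding triangle_def standard_simplex_def by (auto simp: sum_upto_2)

lemma face_edge:
  "simplical_face 0 (edge t) = triangle (1 - t, t)"
  "simplical_face 1 (edge t) = triangle (0, t)"
  "simplical_face 2 (edge t) = triangle (t, 0)"
  unfolding simplical_face_def edge_def triangle_def by (rule ext; auto)+

definition log_cochain :: "('x \<Rightarrow> complex) \<Rightarrow> ((nat \<Rightarrow> real) \<Rightarrow> 'x) \<Rightarrow> complex" where
  "log_cochain v \<sigma> = log_change (\<lambda>t. v (\<sigma> (edge t)))"

text \<open>A triangle is contractible, so the map has a single continuous logarithm on it, and its changes
along the three edges cancel.\<close>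

lemma log_cochain_vanishes_on_boundary_of_simplex:
  fixes X :: "'x::topological_space set"
  assumes v: "continuous_on X v" "\<And>x. x \<in> X \<Longrightarrow> v x \<noteq> 0"
    and \<tau>: "singular_simplex 2 (top_of_set X) \<tau>"
  shows "linear_extension (log_cochain v) (chain_boundary 2 (frag_of \<tau>)) = 0"
proof -
  let ?D = "{z::real\<times>real. 0 \<le> fst z \<and> 0 \<le> snd z \<and> fst z + snd z \<le> 1}"
  have D: "convex ?D"
  proof -
    have "?D = {z. (1,0) \<bullet> z \<ge> 0} \<inter> {z. (0,1) \<bullet> z \<ge> 0} \<inter> {z. (1,1) \<bullet> z \<le> 1}"
      by (auto simp: inner_prod_def)
    then show ?thesis by (simp only:) (intro convex_Int convex_halfspace_ge convex_halfspace_le)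
  qed
  have "continuous_map (top_of_set ?D) (powertop_real UNIV) triangle"
    unfolding continuous_map_componentwise_UNIV
  proof
    fix i show "continuous_map (top_of_set ?D) euclideanreal (\<lambda>z. triangle z i)"
      unfolding triangle_def continuous_map_iff_continuous
      by (cases "i = 0"; cases "i = 1"; cases "i = 2") (auto intro!: continuous_intros)
  qed
  then have "continuous_map (top_of_set ?D) (subtopology (powertop_real UNIV) (standard_simplex 2)) triangle"
    unfolding continuous_map_in_subtopology by (auto intro!: triangle_in_simplex)
  then have "continuous_map (top_of_set ?D) (top_of_set X) (\<tau> \<circ> triangle)"
    using \<tau> unfolding singular_simplex_def by (blast intro: continuous_map_compose)
  then have \<tau>t: "continuous_on ?D (\<tau> \<circ> triangle)" "(\<tau> \<circ> triangle) ` ?D \<subseteq> X"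
    by (auto simp: continuous_map_subtopology_eu image_subset_iff_funcset)
  have vD: "continuous_on ?D (\<lambda>z. v (\<tau> (triangle z)))"
    using continuous_on_compose2[OF v(1) \<tau>t(1)] \<tau>t(2) by (simp add: o_def)
  have contr: "contractible ?D" using D by (rule convex_imp_contractible)
  have nz: "v (\<tau> (triangle z)) \<noteq> 0" if "z \<in> ?D" for z using \<tau>t(2) v(2) that by auto
  obtain G where G: "continuous_on ?D G" "\<And>z. z \<in> ?D \<Longrightarrow> v (\<tau> (triangle z)) = exp (G z)"
    by (rule continuous_logarithm_on_contractible[OF vD contr nz]) (assumption, rule that)
  have face: "log_cochain v (singular_face 2 k \<tau>) = G (f 1) - G (f 0)"
    if f: "continuous_on {0..1} f" "f ` {0..1} \<subseteq> ?D" "\<And>t. simplical_face k (edge t) = triangle (f t)" for k f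
  proof -
    have "log_cochain v (singular_face 2 k \<tau>) = log_change (\<lambda>t. v (singular_face 2 k \<tau> (edge t)))"
      by (simp add: log_cochain_def)
    also have "\<dots> = (G \<circ> f) 1 - (G \<circ> f) 0"
    proof (rule log_change_eq)
      show "continuous_on {0..1} (G \<circ> f)"
        using f G(1) by (meson continuous_on_compose continuous_on_subset)
      fix t :: real assume t: "t \<in> {0..1}"
      then have "singular_face 2 k \<tau> (edge t) = \<tau> (triangle (f t))"
        using edge_in_simplex[OF t] f(3) by (simp add: singular_face_def)
      then show "exp ((G \<circ> f) t) = v (singular_face 2 k \<tau> (edge t))"
        using G(2)[of "f t"] f(2) t by (simp add: image_subset_iff)
    qed
    finally show ?thesis by simp
  qed
  have "log_cochain v (singular_face 2 0 \<tau>) = G (0,1) - G (1,0)"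
    by (subst face[of "\<lambda>t. (1 - t, t)"]) (auto simp: face_edge intro!: continuous_intros)
  moreover have "log_cochain v (singular_face 2 1 \<tau>) = G (0,1) - G (0,0)"
    by (subst face[of "\<lambda>t. (0, t)"]) (auto simp: face_edge[simplified] intro!: continuous_intros)
  moreover have "log_cochain v (singular_face 2 2 \<tau>) = G (1,0) - G (0,0)"
    by (subst face[of "\<lambda>t. (t, 0)"]) (auto simp: face_edge intro!: continuous_intros)
  ultimately show ?thesis
    by (simp add: chain_boundary_of sum_upto_2 linear_extension_add linear_extension_diff
        del: One_nat_def)
qed

lemma log_cochain_vanishes_on_boundaries:
  fixes X :: "'x::topological_space set"
  assumes v: "continuous_on X v" "\<And>x. x \<in> X \<Longrightarrow> v x \<noteq> 0"
    and c: "singular_chain 2 (top_of_set X) c"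
  shows "linear_extension (log_cochain v) (chain_boundary 2 c) = 0"
  using c unfolding singular_chain_def
  by (induction c rule: frag_induction)
     (auto simp: log_cochain_vanishes_on_boundary_of_simplex[OF v] chain_boundary_diff linear_extension_diff)

lemma cycle_is_boundary:
  assumes H: "trivial_group (homology_group 1 X)" and c: "singular_chain 1 X c" "chain_boundary 1 c = 0"
  obtains d where "singular_chain 2 X d" "chain_boundary 2 d = c"
proof -
  have "singular_relcycle 1 X {} c" using c by (simp add: singular_cycle)
  then have "homologous_rel_set 1 X {} c \<in> carrier (homology_group (int 1) X)"
    unfolding carrier_relative_homology_group by blast
  also have "carrier (homology_group (int 1) X) = {\<one>\<^bsub>homology_group (int 1) X\<^esub>}"
    using H unfolding trivial_group_def by simp
  finally have "homologous_rel_set 1 X {} c = singular_relboundary_set 1 X {}"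
    unfolding one_relative_homology_group by blast
  then have "singular_relboundary 1 X {} c" unfolding homologous_rel_set_eq_relboundary .
  then show ?thesis using that unfolding singular_boundary by (auto simp: numeral_2_eq_2)
qed

text \<open>The paths form a singular cycle, because their end points are, with multiplicity, their starting points.  This
cycle bounds, as \<open>H\<^sub>1(X) = 0\<close>, and \<open>log_cochain v\<close> vanishes on boundaries.\<close>

theorem log_changes_along_cycle:
  fixes X :: "'x::topological_space set" and v :: "'x \<Rightarrow> complex"
  assumes H: "trivial_group (homology_group 1 (top_of_set X))"
    and v: "continuous_on X v" "\<And>x. x \<in> X \<Longrightarrow> v x \<noteq> 0"
    and I: "finite I" and c: "\<And>i. i \<in> I \<Longrightarrow> path (c i)" "\<And>i. i \<in> I \<Longrightarrow> path_image (c i) \<subseteq> X"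
    and cycle: "(\<Sum>i\<in>I. frag_of (c i 1)) = (\<Sum>i\<in>I. frag_of (c i 0))"
    and g: "\<And>i. i \<in> I \<Longrightarrow> continuous_on {0..1} (g i)"
      "\<And>i t. i \<in> I \<Longrightarrow> t \<in> {0..1} \<Longrightarrow> exp (g i t) = v (c i t)"
  shows "(\<Sum>i\<in>I. g i 1 - g i 0) = 0"
proof -
  define \<sigma> where "\<sigma> i = restrict (\<lambda>z. c i (z 1)) (standard_simplex 1)" for i
  define point where "point x = restrict (\<lambda>z. x) (standard_simplex 0)" for x :: 'x
  have simplex: "singular_simplex 1 (top_of_set X) (\<sigma> i)" if i: "i \<in> I" for i
  proof -
    have "continuous_map (subtopology (powertop_real UNIV) (standard_simplex 1)) (top_of_set {0..1}) (\<lambda>z. z 1)"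
      unfolding continuous_map_in_subtopology
      by (auto intro!: continuous_map_from_subtopology continuous_map_product_projection simp: standard_simplex_def)
    moreover have "continuous_map (top_of_set {0..1}) (top_of_set X) (c i)"
      using c[OF i] by (auto simp: continuous_map_subtopology_eu path_def path_image_def image_subset_iff_funcset)
    ultimately have "continuous_map (subtopology (powertop_real UNIV) (standard_simplex 1)) (top_of_set X) (c i \<circ> (\<lambda>z. z 1))"
      by (rule continuous_map_compose)
    then show ?thesis
      unfolding singular_simplex_def \<sigma>_def by (auto simp: o_def elim: continuous_map_eq)
  qed
  have faces: "singular_face 1 0 (\<sigma> i) = point (c i 1)" "singular_face 1 1 (\<sigma> i) = point (c i 0)" for i
    unfolding singular_face_def \<sigma>_def point_def
    by (auto simp: fun_eq_iff restrict_def simplical_face_in_standard_simplex standard_simplex_0 simplical_face_def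
        standard_simplex_def)
  have "chain_boundary 1 (\<Sum>i\<in>I. frag_of (\<sigma> i)) = (\<Sum>i\<in>I. frag_of (point (c i 1)) - frag_of (point (c i 0)))"
    unfolding chain_boundary_sum
    by (intro sum.cong) (auto simp: chain_boundary_of faces[simplified])
  also have "\<dots> = frag_extend (frag_of \<circ> point) ((\<Sum>i\<in>I. frag_of (c i 1)) - (\<Sum>i\<in>I. frag_of (c i 0)))"
    by (simp add: frag_extend_diff frag_extend_sum I sum_subtractf)
  also have "\<dots> = 0" using cycle by simp
  finally have bd: "chain_boundary 1 (\<Sum>i\<in>I. frag_of (\<sigma> i)) = 0" .
  have "singular_chain 1 (top_of_set X) (\<Sum>i\<in>I. frag_of (\<sigma> i))"
    by (intro singular_chain_sum) (simp add: singular_chain_of simplex[simplified])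
  then obtain d where d: "singular_chain 2 (top_of_set X) d" "chain_boundary 2 d = (\<Sum>i\<in>I. frag_of (\<sigma> i))"
    using cycle_is_boundary[OF H _ bd] by metis
  have "log_cochain v (\<sigma> i) = g i 1 - g i 0" if i: "i \<in> I" for i
    unfolding log_cochain_def
  proof (rule log_change_eq[OF g(1)[OF i]])
    fix t :: real assume t: "t \<in> {0..1}"
    have "\<sigma> i (edge t) = c i t" using edge_in_simplex[OF t] by (simp add: \<sigma>_def edge_def)
    then show "exp (g i t) = v (\<sigma> i (edge t))" using g(2)[OF i t] by simp
  qed
  then have "(\<Sum>i\<in>I. g i 1 - g i 0) = linear_extension (log_cochain v) (\<Sum>i\<in>I. frag_of (\<sigma> i))"
    by (simp add: linear_extension_sum I)
  also have "\<dots> = 0"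
    using log_cochain_vanishes_on_boundaries[OF v d(1)] d(2) by simp
  finally show ?thesis .
qed

section \<open>Sheets over the complement of a hypersurface\<close>

text \<open>A region \<open>V\<close> which \<open>A\<close> cuts into exactly two sides \<open>P\<close> and \<open>Q\<close>.  The order of the sides records a
direction of crossing.\<close>

definition crossing :: "'b::topological_space set \<Rightarrow> 'b set \<Rightarrow> 'b set \<Rightarrow> 'b set \<Rightarrow> bool" where
  "crossing A V P Q \<longleftrightarrow> open V \<and> connected V \<and> open P \<and> open Q \<and> connected P \<and> connected Q \<and>
     P \<inter> Q = {} \<and> V - A = P \<union> Q \<and> V \<inter> A \<noteq> {} \<and> V \<inter> A \<subseteq> closure P \<inter> closure Q"

lemma crossing_swap: "crossing A V P Q \<longleftrightarrow> crossing A V Q P"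
  unfolding crossing_def by blast

lemma crossing_meets:
  assumes "crossing A V P Q" "a \<in> V" "a \<in> A" "open N" "a \<in> N"
  shows "N \<inter> P \<noteq> {}" "N \<inter> Q \<noteq> {}"
proof -
  have a: "a \<in> closure P" "a \<in> closure Q" using assms(1-3) unfolding crossing_def by blast+
  then show "N \<inter> P \<noteq> {}" "N \<inter> Q \<noteq> {}" using assms(4,5) open_Int_closure_eq_empty by blast+
qed

lemma crossing_nonempty: "crossing A V P Q \<Longrightarrow> P \<noteq> {} \<and> Q \<noteq> {}"
  unfolding crossing_def by force

text \<open>The two smaller sides cannot lie on the same larger side, since both larger sides accumulate at every
point of \<open>A\<close>.\<close>

lemma crossing_sides:
  assumes 1: "crossing A V P Q" and 2: "crossing A V' P' Q'" and sub: "V' \<subseteq> V"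
  shows "(P' \<subseteq> P \<and> Q' \<subseteq> Q) \<or> (P' \<subseteq> Q \<and> Q' \<subseteq> P)"
proof -
  have PQ: "open P" "open Q" "P \<inter> Q = {}" "P \<union> Q = V - A" using 1 unfolding crossing_def by auto
  have side: "K \<subseteq> P \<or> K \<subseteq> Q" if "connected K" "K \<subseteq> V' - A" for K
  proof -
    have "K \<subseteq> P \<union> Q" using that sub PQ(4) by blast
    then show ?thesis using connectedD[OF that(1) PQ(1,2)] PQ(3) by blast
  qed
  have "P' \<subseteq> P \<or> P' \<subseteq> Q" "Q' \<subseteq> P \<or> Q' \<subseteq> Q"
    using side[of P'] side[of Q'] 2 unfolding crossing_def by auto
  moreover have False if "P' \<union> Q' \<subseteq> P \<or> P' \<union> Q' \<subseteq> Q"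
  proof -
    obtain a where a: "a \<in> V'" "a \<in> A" using 2 unfolding crossing_def by blast
    have V': "open V'" "V' - A = P' \<union> Q'" using 2 unfolding crossing_def by auto
    have "V' \<inter> P \<noteq> {}" "V' \<inter> Q \<noteq> {}"
      using crossing_meets[OF 1, of a V'] a sub V'(1) by auto
    moreover have "P \<inter> A = {}" "Q \<inter> A = {}" using PQ(4) by auto
    ultimately show False using that V'(2) PQ(3) by blast
  qed
  ultimately show ?thesis by blast
qed

lemma section_image_open:
  assumes cov: "covering_space C p S" and V: "openin (top_of_set S) V" and g: "is_section C p V g"
  shows "openin (top_of_set C) (g ` V)"
proof (subst openin_subopen, intro ballI)
  fix z assume "z \<in> g ` V"
  then obtain y where y: "y \<in> V" "z = g y" by blast
  have VS: "V \<subseteq> S" using V openin_imp_subset by blast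
  have z: "z \<in> C" "p z = y" using g y unfolding is_lift_def by auto
  obtain u where u: "z \<in> u" "openin (top_of_set C) u" "inj_on p u"
    using evenly_covered[OF cov subsetD[OF VS y(1)]] z by metis
  define O' where "O' = V \<inter> g -` u"
  have "openin (top_of_set V) O'"
    unfolding O'_def by (rule continuous_openin_preimage[of _ _ C]) (use g u in \<open>auto simp: is_lift_def\<close>)
  then have "openin (top_of_set S) O'" using V by (rule openin_trans)
  then have "openin (top_of_set C) (C \<inter> p -` O')"
    by (intro continuous_openin_preimage[of _ _ S])
       (use cov in \<open>auto simp: covering_space_def\<close>)
  then have "openin (top_of_set C) (C \<inter> p -` O' \<inter> u)" using u(2) by blast
  moreover have "z \<in> C \<inter> p -` O' \<inter> u" using z y u(1) unfolding O'_def by auto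
  moreover have "C \<inter> p -` O' \<inter> u \<subseteq> g ` V"
  proof
    fix z' assume z': "z' \<in> C \<inter> p -` O' \<inter> u"
    then have "g (p z') \<in> u" "p (g (p z')) = p z'" "p z' \<in> V" using g unfolding O'_def is_lift_def by auto
    then have "g (p z') = z'" using z' u(3) by (auto dest: inj_onD)
    then show "z' \<in> g ` V" using \<open>p z' \<in> V\<close> by (metis imageI)
  qed
  ultimately show "\<exists>T. openin (top_of_set C) T \<and> z \<in> T \<and> T \<subseteq> g ` V" by blast
qed

text \<open>A covering of \<open>M\<close>, where \<open>A\<close> is closed in \<open>M\<close> and cuts \<open>M\<close> locally into two sides, with a simply connected
complement.  The sheets over the complement are indexed by the fibre over the base point \<open>x0\<close>.\<close>

locale cut_covering =
  fixes W :: "'x::topological_space set" and p :: "'x \<Rightarrow> 'b::euclidean_space" and M A :: "'b set" and x0 :: 'b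
  assumes cov: "covering_space W p M"
    and open_M: "open M" and A_sub: "A \<subseteq> M"
    and open_cut: "open (M - A)" and sc: "simply_connected (M - A)"
    and x0: "x0 \<in> M - A"
    and crossings: "\<And>a N. a \<in> A \<Longrightarrow> open N \<Longrightarrow> a \<in> N \<Longrightarrow> \<exists>V P Q. crossing A V P Q \<and> a \<in> V \<and> V \<subseteq> N"
begin

definition fibre where "fibre = {w \<in> W. p w = x0}"

definition sheet where "sheet w = (SOME g. is_section W p (M - A) g \<and> g x0 = w)"

lemma sheet_section: assumes "w \<in> fibre" shows "is_section W p (M - A) (sheet w)" and "sheet w x0 = w"
proof -
  have "\<exists>g. is_section W p (M - A) g \<and> g x0 = w"
    using has_sections_simply_connected[OF cov open_cut sc] assms x0
    unfolding has_lifts_def fibre_def by blast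
  then have "is_section W p (M - A) (sheet w) \<and> sheet w x0 = w" unfolding sheet_def by (rule someI_ex)
  then show "is_section W p (M - A) (sheet w)" "sheet w x0 = w" by auto
qed

lemma sheet_in: "w \<in> fibre \<Longrightarrow> y \<in> M - A \<Longrightarrow> sheet w y \<in> W" and p_sheet: "w \<in> fibre \<Longrightarrow> y \<in> M - A \<Longrightarrow> p (sheet w y) = y"
  using sheet_section(1) unfolding is_lift_def by auto

lemma connected_cut: "connected (M - A)"
  using sc simply_connected_imp_connected by blast

lemma sheet_inj: assumes "w \<in> fibre" "w' \<in> fibre" "y \<in> M - A" "sheet w y = sheet w' y" shows "w = w'"
  using lift_unique[OF cov connected_cut sheet_section(1)[OF assms(1)] sheet_section(1)[OF assms(2)] assms(3,4) x0]
    sheet_section(2) assms by simp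

lemma sheet_cover: assumes "z \<in> W" "p z \<in> M - A" obtains w where "w \<in> fibre" "sheet w (p z) = z"
proof -
  obtain g where g: "is_section W p (M - A) g" "g (p z) = z"
    using has_sections_simply_connected[OF cov open_cut sc] assms unfolding has_lifts_def by blast
  have w: "g x0 \<in> fibre" using g(1) x0 unfolding fibre_def is_lift_def by auto
  have "sheet (g x0) (p z) = g (p z)"
    using lift_unique[OF cov connected_cut sheet_section(1)[OF w] g(1) x0 sheet_section(2)[OF w] assms(2)] .
  then show ?thesis using that w g(2) by simp
qed

text \<open>Crossings over which sections exist through every point; near a given point of \<open>A\<close>, all sufficiently small crossings are of this kind.\<close>

definition covered_crossing where "covered_crossing V P Q \<longleftrightarrow> crossing A V P Q \<and> V \<subseteq> M \<and> has_sections W p V"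

lemma covered_crossing_swap: "covered_crossing V P Q \<longleftrightarrow> covered_crossing V Q P"
  unfolding covered_crossing_def using crossing_swap by blast

lemma covered_crossing_exists:
  assumes "a \<in> A" "open N" "a \<in> N"
  shows "\<exists>V P Q. covered_crossing V P Q \<and> a \<in> V \<and> V \<subseteq> N"
proof -
  have "a \<in> M" using assms(1) A_sub by blast
  then obtain T where T: "a \<in> T" "openin (top_of_set M) T"
    "\<And>w. w \<in> W \<Longrightarrow> p w \<in> T \<Longrightarrow> \<exists>u q. w \<in> u \<and> openin (top_of_set W) u \<and> homeomorphism u T p q"
    using evenly_covered[OF cov] by metis
  have "open T" using T(2) open_M openin_open_eq by blast
  then have "open (N \<inter> T)" using assms(2) by blast
  then obtain V P Q where V: "crossing A V P Q" "a \<in> V" "V \<subseteq> N \<inter> T"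
    using crossings[OF assms(1), of "N \<inter> T"] assms T(1) by blast
  have "has_sections W p V"
    by (rule lift_into_evenly_covered[OF T(3)]) (use V in auto)
  moreover have "V \<subseteq> M" using V(3) T(2) openin_imp_subset by blast
  ultimately show ?thesis using V unfolding covered_crossing_def by blast
qed

text \<open>The sheets on which one starts and arrives when crossing from \<open>P\<close> to \<open>Q\<close> upstairs.  On the fibre
it is the graph of a permutation, by the lemmas below; as a relation its inverse is simply its converse.\<close>

definition monodromy where
  "monodromy V P Q = {(w,w'). w \<in> fibre \<and> w' \<in> fibre \<and>
     (\<exists>g. is_section W p V g \<and> (\<forall>y\<in>P. g y = sheet w y) \<and> (\<forall>y\<in>Q. g y = sheet w' y))}"

lemma monodromy_converse: "monodromy V Q P = (monodromy V P Q)\<inverse>"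
  unfolding monodromy_def by blast

lemma covered_crossing_sides: assumes "covered_crossing V P Q"
  shows "P \<subseteq> V" "Q \<subseteq> V" "P \<subseteq> M - A" "Q \<subseteq> M - A" "P \<noteq> {}" "Q \<noteq> {}" "connected P" "connected Q" "connected V"
    "V \<inter> (M - A) = P \<union> Q" "open V"
  using assms crossing_nonempty[of A V P Q] unfolding covered_crossing_def crossing_def by auto

lemma section_on_side:
  assumes g: "is_section W p V g" and P: "P \<subseteq> V" "P \<subseteq> M - A" "P \<noteq> {}" "connected P"
  obtains w where "w \<in> fibre" "\<And>y. y \<in> P \<Longrightarrow> g y = sheet w y"
proof -
  obtain y0 where y0: "y0 \<in> P" using P(3) by blast
  have gy: "g y0 \<in> W" "p (g y0) = y0" using g P(1) y0 unfolding is_lift_def by auto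
  then obtain w where w: "w \<in> fibre" "sheet w (p (g y0)) = g y0"
    using sheet_cover[of "g y0"] P(2) y0 by auto
  have "g y = sheet w y" if "y \<in> P" for y
    by (rule lift_unique[OF cov P(4) is_lift_subset[OF g P(1)] is_lift_subset[OF sheet_section(1)[OF w(1)] P(2)] y0 _ that])
       (use w gy in simp)
  then show ?thesis using that w by blast
qed

lemma monodromy_total: assumes c: "covered_crossing V P Q" and w: "w \<in> fibre" shows "\<exists>w'. (w,w') \<in> monodromy V P Q"
proof -
  note ch = covered_crossing_sides[OF c]
  obtain y0 where y0: "y0 \<in> P" using ch(5) by blast
  have "sheet w y0 \<in> W" "p (sheet w y0) = y0" using sheet_in p_sheet w ch(3) y0 by blast+
  then obtain g where g: "is_section W p V g" "g y0 = sheet w y0"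
    using c y0 ch(1) unfolding covered_crossing_def has_lifts_def by blast
  have gP: "g y = sheet w y" if "y \<in> P" for y
    by (rule lift_unique[OF cov ch(7) is_lift_subset[OF g(1) ch(1)] is_lift_subset[OF sheet_section(1)[OF w] ch(3)] y0 g(2) that])
  obtain w' where "w' \<in> fibre" "\<And>y. y \<in> Q \<Longrightarrow> g y = sheet w' y"
    using section_on_side[OF g(1) ch(2,4,6,8)] by metis
  then have "(w, w') \<in> monodromy V P Q" unfolding monodromy_def using w g(1) gP by blast
  then show ?thesis by blast
qed

lemma monodromy_functional: assumes c: "covered_crossing V P Q" and "(w,w') \<in> monodromy V P Q" "(w,w'') \<in> monodromy V P Q" shows "w' = w''"
proof -
  note ch = covered_crossing_sides[OF c]
  obtain g where g: "w \<in> fibre" "w' \<in> fibre" "is_section W p V g" "\<forall>y\<in>P. g y = sheet w y" "\<forall>y\<in>Q. g y = sheet w' y"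
    using assms(2) unfolding monodromy_def by blast
  obtain h where h: "w'' \<in> fibre" "is_section W p V h" "\<forall>y\<in>P. h y = sheet w y" "\<forall>y\<in>Q. h y = sheet w'' y"
    using assms(3) unfolding monodromy_def by blast
  obtain y z where yz: "y \<in> P" "z \<in> Q" using ch(5,6) by blast
  have "g z = h z"
    by (rule lift_unique[OF cov ch(9) g(3) h(2), of y]) (use yz g h ch in auto)
  then have "sheet w' z = sheet w'' z" using g(5) h(4) yz by auto
  then show ?thesis using sheet_inj g(2) h(1) yz ch(4) by blast
qed

lemma monodromy_injective: "covered_crossing V P Q \<Longrightarrow> (w,w') \<in> monodromy V P Q \<Longrightarrow> (v,w') \<in> monodromy V P Q \<Longrightarrow> w = v"
  using monodromy_functional[of V Q P w' w v] monodromy_converse[of V Q P] covered_crossing_swap by auto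

lemma monodromy_in: "(w,w') \<in> monodromy V P Q \<Longrightarrow> w \<in> fibre \<and> w' \<in> fibre"
  unfolding monodromy_def by blast

lemma monodromy_restrict:
  assumes c: "covered_crossing V P Q" "covered_crossing V' P' Q'" and sub: "V' \<subseteq> V" "P' \<subseteq> P" "Q' \<subseteq> Q"
  shows "monodromy V' P' Q' = monodromy V P Q"
proof -
  have 1: "monodromy V P Q \<subseteq> monodromy V' P' Q'"
    unfolding monodromy_def using sub is_lift_subset[OF _ sub(1)] by blast
  moreover have "monodromy V' P' Q' \<subseteq> monodromy V P Q"
  proof (clarify)
    fix w w' assume w: "(w,w') \<in> monodromy V' P' Q'"
    then obtain w'' where "(w,w'') \<in> monodromy V P Q" using monodromy_total[OF c(1)] monodromy_in by blast
    then show "(w,w') \<in> monodromy V P Q" using monodromy_functional[OF c(2) w] 1 by blast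
  qed
  ultimately show ?thesis by blast
qed

lemma monodromy_nested:
  assumes c: "covered_crossing V P Q" "covered_crossing V' P' Q'" and sub: "V' \<subseteq> V"
  shows "monodromy V' P' Q' = monodromy V P Q \<or> monodromy V' P' Q' = (monodromy V P Q)\<inverse>"
proof -
  have "(P' \<subseteq> P \<and> Q' \<subseteq> Q) \<or> (P' \<subseteq> Q \<and> Q' \<subseteq> P)"
    using crossing_sides sub c unfolding covered_crossing_def by blast
  then show ?thesis
  proof
    assume "P' \<subseteq> P \<and> Q' \<subseteq> Q" then show ?thesis using monodromy_restrict[OF c sub] by blast
  next
    assume "P' \<subseteq> Q \<and> Q' \<subseteq> P"
    then have "monodromy V' P' Q' = monodromy V Q P" using monodromy_restrict[of V Q P, OF _ c(2) sub] c(1) covered_crossing_swap by blast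
    then show ?thesis using monodromy_converse by blast
  qed
qed

text \<open>Both are compared with a third crossing in the intersection.\<close>

lemma monodromy_common_point:
  assumes c: "covered_crossing V P Q" "covered_crossing V' P' Q'" and a: "a \<in> A" "a \<in> V" "a \<in> V'"
  shows "monodromy V' P' Q' = monodromy V P Q \<or> monodromy V' P' Q' = (monodromy V P Q)\<inverse>"
proof -
  have "open (V \<inter> V')" using covered_crossing_sides(11)[OF c(1)] covered_crossing_sides(11)[OF c(2)] by blast
  then obtain V2 P2 Q2 where 2: "covered_crossing V2 P2 Q2" "V2 \<subseteq> V \<inter> V'"
    using covered_crossing_exists[OF a(1), of "V \<inter> V'"] a(2,3) by blast
  have "V2 \<subseteq> V" "V2 \<subseteq> V'" using 2(2) by auto
  from monodromy_nested[OF c(1) 2(1) this(1)] monodromy_nested[OF c(2) 2(1) this(2)] show ?thesis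
    by (elim disjE) simp_all
qed

lemma monodromy_constant:
  assumes conn: "connected A" and c: "covered_crossing V P Q" "covered_crossing V' P' Q'"
  shows "monodromy V' P' Q' = monodromy V P Q \<or> monodromy V' P' Q' = (monodromy V P Q)\<inverse>"
proof -
  define good where "good a \<longleftrightarrow> (\<forall>V' P' Q'. covered_crossing V' P' Q' \<and> a \<in> V' \<longrightarrow>
      monodromy V' P' Q' = monodromy V P Q \<or> monodromy V' P' Q' = (monodromy V P Q)\<inverse>)" for a
  obtain a where a: "a \<in> A" "a \<in> V" using c(1) unfolding covered_crossing_def crossing_def by blast
  obtain b where b: "b \<in> A" "b \<in> V'" using c(2) unfolding covered_crossing_def crossing_def by blast
  have "good b"
  proof (rule connected_induction_simple[OF conn a(1) b(1)])
    show "good a" unfolding good_def using monodromy_common_point[OF c(1) _ a] by (intro allI impI) (elim conjE)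
    fix x assume "x \<in> A"
    then obtain U R R' where U: "covered_crossing U R R'" "x \<in> U" using covered_crossing_exists[OF _ open_UNIV UNIV_I] by blast
    show "\<exists>T. openin (top_of_set A) T \<and> x \<in> T \<and> (\<forall>y\<in>T. \<forall>z\<in>T. good y \<longrightarrow> good z)"
    proof (intro exI[of _ "A \<inter> U"] conjI ballI impI)
      show "openin (top_of_set A) (A \<inter> U)" using covered_crossing_sides(11)[OF U(1)] by (simp add: openin_open_Int)
      show "x \<in> A \<inter> U" using \<open>x \<in> A\<close> U by blast
      fix y z assume y: "y \<in> A \<inter> U" and z: "z \<in> A \<inter> U" and "good y"
      then have *: "monodromy U R R' = monodromy V P Q \<or> monodromy U R R' = (monodromy V P Q)\<inverse>" unfolding good_def using U(1) by blast
      show "good z" unfolding good_def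
      proof (intro allI impI)
        fix V' P' Q' assume "covered_crossing V' P' Q' \<and> z \<in> V'"
        then have "monodromy V' P' Q' = monodromy U R R' \<or> monodromy V' P' Q' = (monodromy U R R')\<inverse>"
          using monodromy_common_point[OF U(1), of V' P' Q' z] z by blast
        then show "monodromy V' P' Q' = monodromy V P Q \<or> monodromy V' P' Q' = (monodromy V P Q)\<inverse>"
          using * by (elim disjE) simp_all
      qed
    qed
  qed
  then show ?thesis unfolding good_def using c(2) b(2) by blast
qed

definition sheet_index where "sheet_index z = (SOME w. w \<in> fibre \<and> sheet w (p z) = z)"

lemma sheet_index_sheet: assumes "w \<in> fibre" "y \<in> M - A" shows "sheet_index (sheet w y) = w"
  unfolding sheet_index_def
proof (rule some_equality)
  show "w \<in> fibre \<and> sheet w (p (sheet w y)) = sheet w y" using assms p_sheet by simp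
  fix v assume "v \<in> fibre \<and> sheet v (p (sheet w y)) = sheet w y"
  then show "v = w" using sheet_inj[of v w y] assms p_sheet by simp
qed

text \<open>Any point of \<open>W\<close> has a neighbourhood, the image of a section, that meets only sheets related by one
crossing.  Points over \<open>A\<close> are limits of points on sheets, so connectedness of \<open>W\<close> propagates the relation.\<close>

lemma sheets_form_one_orbit:
  assumes conn: "connected W" and r: "\<And>V P Q. covered_crossing V P Q \<Longrightarrow> monodromy V P Q \<subseteq> r"
    and w: "w \<in> fibre" "w' \<in> fibre"
  shows "(w,w') \<in> r\<^sup>*"
proof -
  have sec: "\<exists>T g. openin (top_of_set W) (g ` T) \<and> is_section W p T g \<and> z \<in> g ` T \<and>
      ((T = M - A \<and> (\<exists>w\<in>fibre. g = sheet w)) \<or> (\<exists>P Q. covered_crossing T P Q))" if z: "z \<in> W" for z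
  proof (cases "p z \<in> A")
    case True
    then obtain V P Q where V: "covered_crossing V P Q" "p z \<in> V" using covered_crossing_exists[OF True open_UNIV UNIV_I] by blast
    then obtain g where g: "is_section W p V g" "g (p z) = z"
      using z unfolding covered_crossing_def has_lifts_def by blast
    have "openin (top_of_set M) V" using V covered_crossing_sides(11) open_M unfolding covered_crossing_def by (metis openin_open_eq)
    then have "openin (top_of_set W) (g ` V)" using section_image_open[OF cov _ g(1)] by blast
    moreover have "z \<in> g ` V" using g(2) V(2) by (metis imageI)
    ultimately show ?thesis using g(1) V(1) by blast
  next
    case False
    have "p z \<in> M" using z covering_space_imp_surjective[OF cov] by blast
    with False have pz: "p z \<in> M - A" by blast
    obtain w where w: "w \<in> fibre" "sheet w (p z) = z" using sheet_cover[OF z pz] .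
    have "openin (top_of_set M) (M - A)" using open_cut open_M by (metis openin_open_eq Diff_subset)
    then have "openin (top_of_set W) (sheet w ` (M - A))" using section_image_open[OF cov _ sheet_section(1)[OF w(1)]] by blast
    moreover have "z \<in> sheet w ` (M - A)" using w(2) pz by (metis imageI)
    ultimately show ?thesis using sheet_section(1)[OF w(1)] w(1) by blast
  qed
  have "(sheet_index w, sheet_index w') \<in> r\<^sup>*"
  proof (rule connected_equivalence_relation_gen[OF conn, of w w' "\<lambda>z. p z \<in> M - A" "\<lambda>x y. (sheet_index x, sheet_index y) \<in> r\<^sup>*"])
    show "w \<in> W" "w' \<in> W" "p w \<in> M - A" "p w' \<in> M - A" using w x0 unfolding fibre_def by auto
    show "(sheet_index x, sheet_index z) \<in> r\<^sup>*" if "(sheet_index x, sheet_index y) \<in> r\<^sup>*" "(sheet_index y, sheet_index z) \<in> r\<^sup>*" for x y z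
      using that by (rule rtrancl_trans)
  next
    fix T z assume T: "openin (top_of_set W) T" "z \<in> T"
    have zW: "z \<in> W" using T openin_imp_subset by blast
    show "\<exists>z. z \<in> T \<and> p z \<in> M - A"
    proof (cases "p z \<in> A")
      case True
      then obtain V P Q where V: "covered_crossing V P Q" "p z \<in> V" using covered_crossing_exists[OF True open_UNIV UNIV_I] by blast
      then obtain g where g: "is_section W p V g" "g (p z) = z"
        using zW unfolding covered_crossing_def has_lifts_def by blast
      have "openin (top_of_set V) (V \<inter> g -` T)"
        by (rule continuous_openin_preimage[of _ _ W]) (use g T in \<open>auto simp: is_lift_def\<close>)
      then have "open (V \<inter> g -` T)" using covered_crossing_sides(11)[OF V(1)] openin_open_eq by blast
      moreover have "p z \<in> V \<inter> g -` T" using V(2) g(2) T(2) by auto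
      ultimately have "V \<inter> g -` T \<inter> P \<noteq> {}"
        using crossing_meets(1)[of A V P Q "p z"] V True unfolding covered_crossing_def by blast
      then obtain y where y: "y \<in> V" "g y \<in> T" "y \<in> P" by blast
      moreover have "p (g y) = y" using g(1) y(1) unfolding is_lift_def by blast
      ultimately show ?thesis using covered_crossing_sides(3)[OF V(1)] by (intro exI[of _ "g y"]) auto
    next
      case False
      then show ?thesis using T zW covering_space_imp_surjective[OF cov] by blast
    qed
  next
    fix z assume z: "z \<in> W"
    obtain T g where T: "openin (top_of_set W) (g ` T)" "is_section W p T g" "z \<in> g ` T"
      "(T = M - A \<and> (\<exists>w\<in>fibre. g = sheet w)) \<or> (\<exists>P Q. covered_crossing T P Q)"
      using sec[OF z] by blast
    have "(sheet_index (g x), sheet_index (g y)) \<in> r\<^sup>*" if xy: "x \<in> T" "y \<in> T" "x \<in> M - A" "y \<in> M - A" for x y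
      using T(4)
    proof (elim disjE conjE bexE exE)
      fix w assume "w \<in> fibre" "g = sheet w"
      then show ?thesis using sheet_index_sheet xy by simp
    next
      fix P Q assume c: "covered_crossing T P Q"
      note ch = covered_crossing_sides[OF c]
      obtain v where v: "v \<in> fibre" "\<And>y. y \<in> P \<Longrightarrow> g y = sheet v y" using section_on_side[OF T(2) ch(1,3,5,7)] by metis
      obtain v' where v': "v' \<in> fibre" "\<And>y. y \<in> Q \<Longrightarrow> g y = sheet v' y" using section_on_side[OF T(2) ch(2,4,6,8)] by metis
      have "(v,v') \<in> monodromy T P Q" unfolding monodromy_def using v v' T(2) by blast
      then have "(v,v') \<in> r" "(v',v) \<in> r" using r[OF c] r[of T Q P] c covered_crossing_swap monodromy_converse[of T Q P] by blast+
      moreover have "sheet_index (g y) \<in> {v,v'}" if "y \<in> T" "y \<in> M - A" for y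
      proof -
        have "y \<in> P \<union> Q" using ch(10) that by blast
        then show ?thesis using v v' sheet_index_sheet that(2) by auto
      qed
      ultimately show ?thesis using xy by (metis insertE r_into_rtrancl rtrancl.rtrancl_refl singletonD)
    qed
    then have "\<forall>x\<in>g ` T. \<forall>y\<in>g ` T. p x \<in> M - A \<and> p y \<in> M - A \<longrightarrow> (sheet_index x, sheet_index y) \<in> r\<^sup>*"
      using T(2) unfolding is_lift_def by auto
    then show "\<exists>T. openin (top_of_set W) T \<and> z \<in> T \<and> (\<forall>x\<in>T. \<forall>y\<in>T. p x \<in> M - A \<and> p y \<in> M - A \<longrightarrow> (sheet_index x, sheet_index y) \<in> r\<^sup>*)"
      using T(1,3) by blast
  qed
  moreover have "sheet_index v = v" if "v \<in> fibre" for v using sheet_index_sheet[OF that x0] sheet_section(2)[OF that] by simp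
  ultimately show ?thesis using w by simp
qed

lemma one_sheet_if_uncut:
  assumes "connected W" "A = {}" "w \<in> fibre" "w' \<in> fibre" shows "w = w'"
proof -
  have "\<not> covered_crossing V P Q" for V P Q using assms(2) unfolding covered_crossing_def crossing_def by blast
  then have "(w,w') \<in> {}\<^sup>*"
    by (intro sheets_form_one_orbit) (use assms in auto)
  then show ?thesis by simp
qed

lemma orbit_of_crossing:
  assumes "connected W" "connected A" "covered_crossing V P Q" "w \<in> fibre" "w' \<in> fibre"
  shows "(w,w') \<in> (monodromy V P Q \<union> (monodromy V P Q)\<inverse>)\<^sup>*"
  by (rule sheets_form_one_orbit) (use assms monodromy_constant[OF assms(2,3)] in blast)+

lemma one_sheet_if_fixed:
  assumes "connected W" "connected A" and c: "covered_crossing V P Q" and loop: "(w,w) \<in> monodromy V P Q"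
  shows "fibre = {w}"
proof -
  have "v = w" if "v \<in> fibre" for v
  proof -
    have "(w,v) \<in> (monodromy V P Q \<union> (monodromy V P Q)\<inverse>)\<^sup>*" using orbit_of_crossing[OF assms(1-3) _ that, of w] monodromy_in[OF loop] by blast
    then show ?thesis
      by induction (use monodromy_functional[OF c loop] monodromy_injective[OF c loop] in auto)
  qed
  then show ?thesis using monodromy_in[OF loop] by blast
qed

lemma at_most_two_sheets_if_symmetric:
  assumes "connected W" "connected A" and c: "covered_crossing V P Q" and sym: "(monodromy V P Q)\<inverse> = monodromy V P Q"
  shows "card fibre \<le> 2"
proof (cases "fibre = {}")
  case False
  then obtain w where w: "w \<in> fibre" by blast
  obtain w' where w': "(w,w') \<in> monodromy V P Q" using monodromy_total[OF c w] by blast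
  have "v \<in> {w,w'}" if "v \<in> fibre" for v
  proof -
    have "(w,v) \<in> (monodromy V P Q)\<^sup>*" using orbit_of_crossing[OF assms(1-3) w that] sym by simp
    then show ?thesis
    proof induction
      case (step y z)
      moreover have "(w',w) \<in> monodromy V P Q" using w' sym by blast
      ultimately show ?case using monodromy_functional[OF c] w' by blast
    qed auto
  qed
  then have "fibre \<subseteq> {w,w'}" by blast
  then have "card fibre \<le> card {w,w'}" by (intro card_mono) auto
  also have "\<dots> \<le> 2" by (simp add: card_insert_if)
  finally show ?thesis .
qed auto

end

section \<open>Co-orientations and winding\<close>

text \<open>The predicate \<open>N\<close> selects coherently one direction of crossing, at every point of \<open>A\<close>.  The map \<open>u\<close> has real part
\<open>dist(x, - T) - dist(x, A)\<close>, where \<open>T\<close> is a thin neighbourhood of \<open>A\<close>, and imaginary part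
\<open>\<plusminus> min (dist(x, A)) (dist(x, - T))\<close>, the sign being that of the side of \<open>A\<close> within \<open>T\<close>.  Within \<open>M\<close> it is real
only on \<open>A\<close>, where it is positive, and outside \<open>T\<close>, where it is negative.\<close>

lemma coorientation_map:
  fixes A M :: "'b::euclidean_space set"
  assumes "open M" "M \<noteq> UNIV" "A \<subseteq> M" "open (M - A)" "A \<noteq> {}"
    and cross: "\<And>V P Q. N V P Q \<Longrightarrow> crossing A V P Q"
    and small: "\<And>a B. a \<in> A \<Longrightarrow> open B \<Longrightarrow> a \<in> B \<Longrightarrow> \<exists>V P Q. N V P Q \<and> a \<in> V \<and> V \<subseteq> B"
    and coherent: "\<And>V P Q V' P' Q'. N V P Q \<Longrightarrow> N V' P' Q' \<Longrightarrow> V' \<subseteq> V \<Longrightarrow> P' \<subseteq> P \<and> Q' \<subseteq> Q"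
  obtains u :: "'b \<Rightarrow> complex" and V P Q where
    "continuous_on UNIV u" "N V P Q" "V \<subseteq> M" "\<And>y. y \<in> M - A \<Longrightarrow> u y \<notin> \<real>\<^sub>\<ge>\<^sub>0"
    "\<And>y. y \<in> A \<Longrightarrow> u y \<noteq> 0" "\<And>y. y \<in> V \<Longrightarrow> u y \<notin> \<real>\<^sub>\<le>\<^sub>0"
    "\<And>y. y \<in> P \<Longrightarrow> Im (u y) > 0" "\<And>y. y \<in> Q \<Longrightarrow> Im (u y) < 0"
proof -
  have "\<exists>U R R' r V P Q. N U R R' \<and> r > 0 \<and> ball a (3 * r) \<subseteq> U \<and> U \<subseteq> M \<and> N V P Q \<and> a \<in> V \<and> V \<subseteq> ball a r"
    if a: "a \<in> A" for a
  proof -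
    obtain U R R' where U: "N U R R'" "a \<in> U" "U \<subseteq> M"
      using small[OF a \<open>open M\<close>] a \<open>A \<subseteq> M\<close> by blast
    have "open U" using cross[OF U(1)] unfolding crossing_def by blast
    then obtain e where e: "e > 0" "ball a e \<subseteq> U" using U(2) open_contains_ball by blast
    then obtain V P Q where "N V P Q" "a \<in> V" "V \<subseteq> ball a (e/3)" using small[OF a, of "ball a (e/3)"] by auto
    moreover have "ball a (3 * (e/3)) \<subseteq> U" "e/3 > 0" using e by auto
    ultimately show ?thesis using U by blast
  qed
  then have "\<forall>a\<in>A. \<exists>U R R' r V P Q. N U R R' \<and> r > 0 \<and> ball a (3 * r) \<subseteq> U \<and> U \<subseteq> M \<and> N V P Q \<and> a \<in> V \<and> V \<subseteq> ball a r"
    by blast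
  then obtain U R R' r V P Q where *: "\<forall>a\<in>A. N (U a) (R a) (R' a) \<and> r a > 0 \<and> ball a (3 * r a) \<subseteq> U a \<and>
      U a \<subseteq> M \<and> N (V a) (P a) (Q a) \<and> a \<in> V a \<and> V a \<subseteq> ball a (r a)"
    unfolding bchoice_iff by blast
  then have U: "N (U a) (R a) (R' a)" "r a > 0" "ball a (3 * r a) \<subseteq> U a" "U a \<subseteq> M"
    and V: "N (V a) (P a) (Q a)" "a \<in> V a" "V a \<subseteq> ball a (r a)" if "a \<in> A" for a
    using that by auto
  \<comment> \<open>The factor 3 in the choice of the radii makes one of two overlapping regions contain both small ones.\<close>
  have VU: "V b \<subseteq> U a" if ab: "a \<in> A" "b \<in> A" "r b \<le> r a" "V a \<inter> V b \<noteq> {}" for a b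
  proof
    fix y assume y: "y \<in> V b"
    obtain x where x: "x \<in> V a" "x \<in> V b" using ab(4) by blast
    have d: "dist a x < r a" "dist b x < r b" "dist b y < r b" using V(3)[OF ab(1)] V(3)[OF ab(2)] x y by auto
    have "dist a y \<le> dist a x + dist x b + dist b y"
      using dist_triangle[of a y x] dist_triangle[of x y b] by linarith
    then have "dist a y < 3 * r a" using d ab(3) by (simp add: dist_commute)
    then show "y \<in> U a" using U(3)[OF ab(1)] by auto
  qed
  have VV: "V a \<subseteq> U a" if "a \<in> A" for a
    using V[OF that] U[OF that] by (meson dual_order.trans subset_ball mult_le_cancel_right1 less_le_not_le one_le_numeral)
  have disj: "P a \<inter> Q b = {}" if ab: "a \<in> A" "b \<in> A" for a b
  proof (rule ccontr)
    assume ne: "P a \<inter> Q b \<noteq> {}"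
    have sub: "P c \<subseteq> V c" "Q c \<subseteq> V c" if "c \<in> A" for c using cross[OF V(1)[OF that]] unfolding crossing_def by blast+
    have "V a \<inter> V b \<noteq> {}" using ne sub ab by blast
    then obtain c where c: "c \<in> A" "V a \<subseteq> U c" "V b \<subseteq> U c"
      using VU[OF ab] VU[OF ab(2,1)] VV ab by (metis Int_commute linear)
    have "P a \<subseteq> R c" "Q b \<subseteq> R' c" using coherent U(1)[OF c(1)] V(1) ab c by blast+
    moreover have "R c \<inter> R' c = {}" using cross[OF U(1)[OF c(1)]] unfolding crossing_def by blast
    ultimately show False using ne by blast
  qed
  define Np Nm where "Np = (\<Union>a\<in>A. P a)" and "Nm = (\<Union>a\<in>A. Q a)"
  define T where "T = (\<Union>a\<in>A. V a)"
  have opens: "open Np" "open Nm" "open T"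
    unfolding Np_def Nm_def T_def using cross[OF V(1)] unfolding crossing_def by blast+
  have NpNm: "Np \<inter> Nm = {}" unfolding Np_def Nm_def using disj by blast
  have T: "A \<subseteq> T" "T \<subseteq> M" "T - A \<subseteq> Np \<union> Nm"
  proof -
    show "A \<subseteq> T" unfolding T_def using V by blast
    show "T \<subseteq> M" unfolding T_def using VV U by blast
    show "T - A \<subseteq> Np \<union> Nm" 
    proof
      fix x assume "x \<in> T - A"
      then obtain a where "a \<in> A" "x \<in> V a - A" unfolding T_def by blast
      moreover have "V a - A = P a \<union> Q a" using cross[OF V(1)[OF \<open>a \<in> A\<close>]] unfolding crossing_def by blast
      ultimately show "x \<in> Np \<union> Nm" unfolding Np_def Nm_def by blast
    qed
  qed
  have notA: "Np \<inter> A = {}" "Nm \<inter> A = {}"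
    unfolding Np_def Nm_def using cross[OF V(1)] unfolding crossing_def by blast+
  have sub: "Np \<subseteq> T" "Nm \<subseteq> T"
    unfolding Np_def Nm_def T_def using cross[OF V(1)] unfolding crossing_def by blast+
  define dA where "dA x = infdist x A" for x
  define dT where "dT x = infdist x (- T)" for x
  have dA_pos: "dA x > 0" if "x \<in> M - A" for x
  proof -
    obtain e where "e > 0" "ball x e \<subseteq> M - A" using assms(4) \<open>x \<in> M - A\<close> open_contains_ball by blast
    then have "e \<le> infdist x A" using \<open>A \<noteq> {}\<close> 
      by (auto simp: infdist_def intro!: cINF_greatest) (metis DiffD2 mem_ball not_le subsetD)
    then show ?thesis using \<open>e > 0\<close> unfolding dA_def by simp
  qed
  have T_ne: "- T \<noteq> {}" using T(2) \<open>M \<noteq> UNIV\<close> by blast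
  have dT_pos: "dT x > 0 \<longleftrightarrow> x \<in> T" for x
    using in_closed_iff_infdist_zero[of "- T" x] opens(3) T_ne infdist_nonneg[of x "- T"]
    unfolding dT_def by (auto simp: less_le closed_Compl)
  have nn: "dA x \<ge> 0" "dT x \<ge> 0" for x unfolding dA_def dT_def by (simp_all add: infdist_nonneg)
  have dA_0: "dA x = 0" if "x \<in> A" for x using that unfolding dA_def by simp
  define m where "m x = min (dA x) (dT x)" for x
  define \<beta> where "\<beta> x = (if x \<in> Np then m x else if x \<in> Nm then - m x else 0)" for x
  have cm: "continuous_on UNIV dA" "continuous_on UNIV dT" "continuous_on UNIV m"
    unfolding m_def dA_def dT_def by (intro continuous_intros)+
  have c\<beta>: "continuous (at x) \<beta>" for x
  proof (cases "x \<in> Np \<or> x \<in> Nm")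
    case True
    have cmx: "continuous (at x) m" using cm(3) by (simp add: continuous_on_eq_continuous_at)
    from True show ?thesis
    proof
      assume "x \<in> Np"
      show ?thesis
        by (rule isCont_cong[THEN iffD1, OF _ cmx])
           (use opens(1) \<open>x \<in> Np\<close> in \<open>auto simp: eventually_nhds \<beta>_def\<close>)
    next
      assume "x \<in> Nm"
      have "continuous (at x) (\<lambda>x. - m x)" using cmx by (intro continuous_intros)
      then show ?thesis
        by (rule isCont_cong[THEN iffD1, rotated])
           (use opens(2) \<open>x \<in> Nm\<close> NpNm in \<open>auto simp: eventually_nhds \<beta>_def intro!: exI[of _ Nm]\<close>)
    qed
  next
    case False
    \<comment> \<open>Where the sign is undefined, the modulus tends to zero.\<close>
    have "x \<in> A \<or> x \<notin> T" using False T(3) by blast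
    then have "m x = 0" unfolding m_def using dA_0 nn dT_pos[of x] by (smt (verit))
    then have "(m \<longlongrightarrow> 0) (at x)" using cm(3) by (simp add: continuous_on_eq_continuous_at continuous_at) (metis UNIV_I isCont_def)
    then have "(\<beta> \<longlongrightarrow> 0) (at x)"
      by (rule Lim_null_comparison[rotated]) (auto simp: \<beta>_def m_def nn)
    then show ?thesis using False by (simp add: continuous_at \<beta>_def)
  qed
  define u where "u x = Complex (dT x - dA x) (\<beta> x)" for x
  have cu: "continuous_on UNIV u" unfolding u_def
    using c\<beta> cm by (auto simp: Complex_eq continuous_at_imp_continuous_on intro!: continuous_intros)
  have \<beta>p: "\<beta> x > 0" if "x \<in> Np" for x
  proof -
    have "x \<in> M - A" "x \<in> T" using that notA sub T by blast+
    then show ?thesis using dA_pos dT_pos[of x] that unfolding \<beta>_def m_def by auto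
  qed
  have \<beta>m: "\<beta> x < 0" if "x \<in> Nm" for x
  proof -
    have "x \<in> M - A" "x \<in> T" using that notA sub T by blast+
    then show ?thesis using dA_pos dT_pos[of x] that NpNm unfolding \<beta>_def m_def by auto
  qed
  obtain a where a: "a \<in> A" using \<open>A \<noteq> {}\<close> by blast
  show ?thesis
  proof (rule that[OF cu V(1)[OF a]])
    show "V a \<subseteq> M" using a VV U by blast
    show "u y \<notin> \<real>\<^sub>\<ge>\<^sub>0" if y: "y \<in> M - A" for y
    proof
      assume "u y \<in> \<real>\<^sub>\<ge>\<^sub>0"
      then have "\<beta> y = 0" "dT y - dA y \<ge> 0" unfolding u_def complex_nonneg_Reals_iff by auto
      moreover have "dA y > 0" using dA_pos[OF y] .
      ultimately have "dT y > 0" by linarith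
      then have "y \<in> Np \<or> y \<in> Nm" using T(3) y dT_pos by blast
      then show False using \<beta>p[of y] \<beta>m[of y] \<open>\<beta> y = 0\<close> by auto
    qed
    show "u y \<noteq> 0" if "y \<in> A" for y
      using dA_0[OF that] dT_pos[of y] T(1) that unfolding u_def by (auto simp: complex_eq_iff)
    show "u y \<notin> \<real>\<^sub>\<le>\<^sub>0" if "y \<in> V a" for y
    proof
      assume "u y \<in> \<real>\<^sub>\<le>\<^sub>0"
      then have z: "\<beta> y = 0" "dT y - dA y \<le> 0" unfolding u_def complex_nonpos_Reals_iff by auto
      have "y \<in> T" using that a unfolding T_def by blast
      then have "dT y > 0" using dT_pos by blast
      then have "y \<notin> A" using dA_0[of y] z(2) by auto
      then have "y \<in> Np \<or> y \<in> Nm" using T(3) \<open>y \<in> T\<close> by blast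
      then show False using \<beta>p[of y] \<beta>m[of y] z(1) by auto
    qed
    show "Im (u y) > 0" if "y \<in> P a" for y using \<beta>p[of y] that a unfolding u_def Np_def by auto
    show "Im (u y) < 0" if "y \<in> Q a" for y using \<beta>m[of y] that a unfolding u_def Nm_def by auto
  qed
qed

context cut_covering
begin

text \<open>If the monodromy differs from its inverse, it co-orients \<open>A\<close>.  Let \<open>u\<close> be the resulting map, and
consider the loop \<open>c1\<close> from \<open>y0\<close> to \<open>y1\<close> across \<open>A\<close> followed by \<open>c2\<close> back to \<open>y0\<close> in the complement of \<open>A\<close>.  A logarithm of \<open>u\<close> is
\<open>Ln u\<close> along \<open>c1\<close> and \<open>Ln (- u) + \<i>\<pi>\<close> along \<open>c2\<close>, so \<open>u\<close> winds once.  All lifts of this loop together form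
a cycle upstairs, along which the winding is the number of sheets.\<close>

lemma symmetric_if_trivial_homology:
  assumes H: "trivial_group (homology_group 1 (top_of_set W))"
    and fin: "finite fibre" "fibre \<noteq> {}" and connA: "connected A" and M: "M \<noteq> UNIV"
    and c: "covered_crossing V0 P0 Q0"
  shows "(monodromy V0 P0 Q0)\<inverse> = monodromy V0 P0 Q0"
proof (rule ccontr)
  assume asym: "(monodromy V0 P0 Q0)\<inverse> \<noteq> monodromy V0 P0 Q0"
  define N where "N V P Q \<longleftrightarrow> covered_crossing V P Q \<and> monodromy V P Q = monodromy V0 P0 Q0" for V P Q
  have "A \<noteq> {}" using c unfolding covered_crossing_def crossing_def by blast
  obtain u V P Q where u: "continuous_on UNIV u" "N V P Q" "V \<subseteq> M"
    and u\<Omega>: "\<And>y. y \<in> M - A \<Longrightarrow> u y \<notin> \<real>\<^sub>\<ge>\<^sub>0"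
    and uA: "\<And>y. y \<in> A \<Longrightarrow> u y \<noteq> 0" and uV: "\<And>y. y \<in> V \<Longrightarrow> u y \<notin> \<real>\<^sub>\<le>\<^sub>0"
    and uP: "\<And>y. y \<in> P \<Longrightarrow> Im (u y) > 0" and uQ: "\<And>y. y \<in> Q \<Longrightarrow> Im (u y) < 0"
  proof (rule coorientation_map[OF open_M M A_sub open_cut \<open>A \<noteq> {}\<close>, of N])
    show "crossing A V P Q" if "N V P Q" for V P Q using that unfolding N_def covered_crossing_def by blast
    show "\<exists>V P Q. N V P Q \<and> a \<in> V \<and> V \<subseteq> B" if "a \<in> A" "open B" "a \<in> B" for a B
    proof -
      obtain V P Q where V: "covered_crossing V P Q" "a \<in> V" "V \<subseteq> B" using covered_crossing_exists \<open>a \<in> A\<close> \<open>open B\<close> \<open>a \<in> B\<close> by blast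
      from monodromy_constant[OF connA c V(1)] show ?thesis
      proof
        assume "monodromy V P Q = monodromy V0 P0 Q0" then show ?thesis using V unfolding N_def by blast
      next
        assume "monodromy V P Q = (monodromy V0 P0 Q0)\<inverse>"
        then have "N V Q P" unfolding N_def using V(1) covered_crossing_swap monodromy_converse[of V Q P] by auto
        then show ?thesis using V by blast
      qed
    qed
    show "P' \<subseteq> P \<and> Q' \<subseteq> Q" if n: "N V P Q" "N V' P' Q'" "V' \<subseteq> V" for V P Q V' P' Q'
    proof (rule ccontr)
      assume "\<not> (P' \<subseteq> P \<and> Q' \<subseteq> Q)"
      then have "P' \<subseteq> Q \<and> Q' \<subseteq> P" using crossing_sides[of A V P Q V' P' Q'] n unfolding N_def covered_crossing_def by blast
      then have "monodromy V' P' Q' = monodromy V Q P"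
        using monodromy_restrict[of V Q P V' P' Q'] n covered_crossing_swap unfolding N_def by blast
      then show False using asym n monodromy_converse[of V Q P] unfolding N_def by auto
    qed
  qed blast
  have ch: "covered_crossing V P Q" using u(2) unfolding N_def by blast
  note cs = covered_crossing_sides[OF ch]
  obtain y1 y0 where y: "y1 \<in> P" "y0 \<in> Q" using cs by blast
  have "path_connected V" using cs(9,11) connected_open_path_connected by blast
  then obtain c1 where c1: "path c1" "path_image c1 \<subseteq> V" "c1 0 = y0" "c1 1 = y1"
    using y cs(1,2) unfolding path_connected_def pathstart_def pathfinish_def by blast
  have "path_connected (M - A)" using sc simply_connected_imp_path_connected by blast
  then obtain c2 where c2: "path c2" "path_image c2 \<subseteq> M - A" "c2 0 = y1" "c2 1 = y0"
    using y cs(3,4) unfolding path_connected_def pathstart_def pathfinish_def by (meson subsetD)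
  have c1V: "c1 t \<in> V" and c2\<Omega>: "c2 t \<in> M - A" if "t \<in> {0..1}" for t
    using c1(2) c2(2) that unfolding path_image_def by blast+
  obtain f where f: "\<And>w. w \<in> fibre \<Longrightarrow> (w, f w) \<in> monodromy V P Q" using monodromy_total[OF ch] by metis
  have "f ` fibre \<subseteq> fibre" "inj_on f fibre"
    using f monodromy_in monodromy_injective[OF ch] by (auto simp: inj_on_def) (metis)+
  then have bij: "bij_betw f fibre fibre" using fin(1) by (simp add: bij_betw_def endo_inj_surj)
  have "\<forall>w\<in>fibre. \<exists>g. is_section W p V g \<and> (\<forall>y\<in>P. g y = sheet w y) \<and> (\<forall>y\<in>Q. g y = sheet (f w) y)"
    using f unfolding monodromy_def by blast
  then obtain \<gamma> where \<gamma>: "\<And>w. w \<in> fibre \<Longrightarrow> is_section W p V (\<gamma> w)"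
    "\<And>w y. w \<in> fibre \<Longrightarrow> y \<in> P \<Longrightarrow> \<gamma> w y = sheet w y" "\<And>w y. w \<in> fibre \<Longrightarrow> y \<in> Q \<Longrightarrow> \<gamma> w y = sheet (f w) y"
    by metis
  define k where "k i = (if snd i then sheet (fst i) \<circ> c2 else \<gamma> (fst i) \<circ> c1)" for i :: "'x \<times> bool"
  define g where "g i t = (if snd i then Ln (- u (c2 t)) + \<i> * pi else Ln (u (c1 t)))" for i :: "'x \<times> bool" and t :: real
  have sum_pairs: "(\<Sum>i\<in>fibre \<times> UNIV. h i) = (\<Sum>w\<in>fibre. h (w, True) + h (w, False))" for h :: "'x \<times> bool \<Rightarrow> 'c::comm_monoid_add"
  proof -
    have "(\<Sum>i\<in>fibre \<times> UNIV. h i) = (\<Sum>w\<in>fibre. \<Sum>b\<in>UNIV. h (w, b))" by (simp add: sum.cartesian_product)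
    then show ?thesis by (simp add: UNIV_bool add.commute)
  qed
  have un0: "u y \<noteq> 0" if "y \<in> M" for y
    using u\<Omega>[of y] uA[of y] that by (cases "y \<in> A") auto
  have contu: "continuous_on S u" for S using u(1) continuous_on_subset by blast
  have "(\<Sum>i\<in>fibre \<times> UNIV. g i 1 - g i 0) = 0"
  proof (rule log_changes_along_cycle[OF H, of "\<lambda>z. u (p z)"])
    show "continuous_on W (\<lambda>z. u (p z))"
      by (rule continuous_on_compose2[OF u(1)]) (use covering_space_imp_continuous[OF cov] in auto)
    show "u (p x) \<noteq> 0" if "x \<in> W" for x using un0 that covering_space_imp_surjective[OF cov] by blast
    show "finite (fibre \<times> (UNIV :: bool set))" using fin by simp
  next
    fix i :: "'x \<times> bool" assume i: "i \<in> fibre \<times> UNIV"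
    obtain w b where wb: "i = (w,b)" "w \<in> fibre" using i by auto
    have s2: "is_lift W p c2 {0..1} (sheet w \<circ> c2)"
      using is_lift_compose[OF sheet_section(1)[OF wb(2)], of "{0..1}" c2] c2 by (auto simp: o_def path_def path_image_def)
    have s1: "is_lift W p c1 {0..1} (\<gamma> w \<circ> c1)"
      using is_lift_compose[OF \<gamma>(1)[OF wb(2)], of "{0..1}" c1] c1 by (auto simp: o_def path_def path_image_def)
    show "path (k i)" "path_image (k i) \<subseteq> W"
      using s1 s2 wb(1) unfolding k_def is_lift_def path_def path_image_def by auto
    show "continuous_on {0..1} (g i)"
    proof (cases b)
      case True
      have "continuous_on {0..1} (\<lambda>t. - u (c2 t))"
        by (intro continuous_intros continuous_on_compose2[OF u(1)]) (use c2 in \<open>auto simp: path_def\<close>)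
      moreover have "- u (c2 t) \<notin> \<real>\<^sub>\<le>\<^sub>0" if "t \<in> {0..1}" for t using u\<Omega>[OF c2\<Omega>[OF that]] by (simp add: complex_nonpos_Reals_iff complex_nonneg_Reals_iff)
      ultimately show ?thesis using True wb unfolding g_def by (auto intro!: continuous_intros)
    next
      case False
      have "continuous_on {0..1} (\<lambda>t. u (c1 t))"
        by (intro continuous_on_compose2[OF u(1)]) (use c1 in \<open>auto simp: path_def\<close>)
      moreover have "u (c1 t) \<notin> \<real>\<^sub>\<le>\<^sub>0" if "t \<in> {0..1}" for t using uV[OF c1V[OF that]] .
      ultimately show ?thesis using False wb unfolding g_def by (auto intro!: continuous_intros)
    qed
    show "exp (g i t) = u (p (k i t))" if t: "t \<in> {0..1}" for t
    proof -
      have "u (c2 t) \<noteq> 0" "u (c1 t) \<noteq> 0" using un0 c1V[OF t] c2\<Omega>[OF t] u(3) by blast+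
      then show ?thesis using s1 s2 t wb unfolding g_def k_def is_lift_def by (simp add: exp_add)
    qed
  next
    have "(\<Sum>i\<in>fibre \<times> UNIV. frag_of (k i 1)) = (\<Sum>w\<in>fibre. frag_of (sheet w y0)) + (\<Sum>w\<in>fibre. frag_of (sheet w y1))"
      unfolding sum_pairs using \<gamma>(2) y by (simp add: k_def c1 c2 sum.distrib)
    also have "(\<Sum>w\<in>fibre. frag_of (sheet w y0)) = (\<Sum>w\<in>fibre. frag_of (sheet (f w) y0))"
      using sum.reindex_bij_betw[OF bij, of "\<lambda>w. frag_of (sheet w y0)"] by simp
    also have "\<dots> + (\<Sum>w\<in>fibre. frag_of (sheet w y1)) = (\<Sum>i\<in>fibre \<times> UNIV. frag_of (k i 0))"
      unfolding sum_pairs using \<gamma>(3) y by (simp add: k_def c1 c2 sum.distrib)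
    finally show "(\<Sum>i\<in>fibre \<times> UNIV. frag_of (k i 1)) = (\<Sum>i\<in>fibre \<times> UNIV. frag_of (k i 0))" .
  qed
  moreover have "g (w, True) 1 - g (w, True) 0 + (g (w, False) 1 - g (w, False) 0) = 2 * pi * \<i>" for w
  proof -
    have "u y1 \<noteq> 0" "u y0 \<noteq> 0" using uP[OF y(1)] uQ[OF y(2)] by auto
    moreover have "Im (u y1) > 0" "Im (u y0) < 0" using uP y uQ by auto
    ultimately show ?thesis by (simp add: g_def c1 c2 Ln_minus)
  qed
  ultimately have "of_nat (card fibre) * (2 * pi * \<i>) = 0" unfolding sum_pairs by simp
  then show False using fin by simp
qed

end

section \<open>Local geometry of submanifolds and complements of codimension two\<close>

lemma homeomorphism_open_image:
  assumes "homeomorphism U V \<phi> \<psi>" "open U" "open V" "open B" "B \<subseteq> V"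
  shows "open (\<psi> ` B)"
proof -
  have "openin (top_of_set V) B" using assms(3-5) by (simp add: openin_open_eq)
  then have "openin (top_of_set U) (\<psi> ` B)"
    using homeomorphism_imp_open_map[OF homeomorphism_symD[OF assms(1)]] by blast
  then show ?thesis using assms(2) openin_open_eq by blast
qed

lemma coordinate_ball:
  fixes \<phi> :: "'a::real_normed_vector \<Rightarrow> 'b::real_normed_vector"
  assumes h: "homeomorphism U V \<phi> \<psi>" "open U" "open V" and a: "a \<in> U" and N: "open N" "a \<in> N"
  obtains e where "e > 0" "ball (\<phi> a) e \<subseteq> V" "\<psi> ` ball (\<phi> a) e \<subseteq> N"
proof -
  have "open (V \<inter> \<psi> -` N)"
    using h N by (meson continuous_open_preimage homeomorphism_def)
  moreover have "\<phi> a \<in> V \<inter> \<psi> -` N"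
    using h(1) a N(2) by (auto simp: homeomorphism_def)
  ultimately obtain e where "e > 0" "ball (\<phi> a) e \<subseteq> V \<inter> \<psi> -` N" using open_contains_ball by blast
  then show ?thesis using that by blast
qed

text \<open>In a chart that flattens \<open>A\<close> to a coordinate hyperplane, take the two halves of a small ball.\<close>

lemma hypersurface_crossing:
  fixes A :: "(real ^ 'n) set"
  assumes A: "submanifold_codim 1 A" and a: "a \<in> A" and N: "open N" "a \<in> N"
  shows "\<exists>V P Q. crossing A V P Q \<and> a \<in> V \<and> V \<subseteq> N"
proof -
  obtain U V \<phi> \<psi> and I :: "'n set" where UV: "a \<in> U" "diffeomorphism U (V :: (real ^ 'n) set) \<phi> \<psi>" "card I = 1"
    "\<phi> ` (U \<inter> A) = V \<inter> {x. \<forall>i\<in>I. x $ i = 0}"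
    using bspec[OF A[unfolded submanifold_codim_def] a] by (elim exE conjE) (rule that; assumption)
  obtain i where I: "I = {i}" using UV(3) card_1_singletonE by blast
  have h: "homeomorphism U V \<phi> \<psi>" "open U" "open V" using UV(2) unfolding diffeomorphism_def by auto
  obtain e where e: "e > 0" "ball (\<phi> a) e \<subseteq> V" "\<psi> ` ball (\<phi> a) e \<subseteq> N"
    using coordinate_ball[OF h UV(1) N] .
  let ?B = "ball (\<phi> a) e"
  have \<phi>\<psi>: "\<phi> (\<psi> x) = x" "\<psi> x \<in> U" if "x \<in> ?B" for x using h(1) e(2) that by (auto simp: homeomorphism_def)
  have inA: "\<psi> x \<in> A \<longleftrightarrow> x $ i = 0" if x: "x \<in> ?B" for x
  proof
    assume "\<psi> x \<in> A"
    then have "\<phi> (\<psi> x) \<in> \<phi> ` (U \<inter> A)" using \<phi>\<psi>[OF x] by blast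
    then show "x $ i = 0" using UV(4) I \<phi>\<psi>[OF x] by auto
  next
    assume "x $ i = 0"
    then have "x \<in> \<phi> ` (U \<inter> A)" using UV(4) I x e(2) by auto
    then show "\<psi> x \<in> A" using h(1) by (auto simp: homeomorphism_def)
  qed
  have inj: "\<psi> x = \<psi> y \<longleftrightarrow> x = y" if "x \<in> ?B" "y \<in> ?B" for x y using \<phi>\<psi> that by metis
  have cont: "continuous_on ?B \<psi>" using h(1) e(2) unfolding homeomorphism_def by (meson continuous_on_subset)
  define Bp Bm where "Bp = ?B \<inter> {x. x $ i > 0}" and "Bm = ?B \<inter> {x. x $ i < 0}"
  have op: "open Bp" "open Bm" unfolding Bp_def Bm_def
    by (auto intro!: open_Int open_halfspace_component_gt_cart open_halfspace_component_lt_cart)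
  have cv: "convex Bp" "convex Bm" unfolding Bp_def Bm_def
    using convex_halfspace_gt[of 0 "axis i (1::real)"] convex_halfspace_lt[of "axis i (1::real)" 0]
    by (auto simp: inner_axis' intro!: convex_Int)
  have near: "\<psi> x \<in> closure (\<psi> ` B')"
    if x: "x \<in> ?B" and B': "\<And>t. t > 0 \<Longrightarrow> x + (c * t) *\<^sub>R axis i 1 \<in> ?B \<Longrightarrow> x + (c * t) *\<^sub>R axis i 1 \<in> B'"
      and c: "\<bar>c\<bar> = 1" for x B' and c :: real
  proof (rule ccontr)
    assume "\<psi> x \<notin> closure (\<psi> ` B')"
    then have "x \<in> ?B \<inter> \<psi> -` (- closure (\<psi> ` B'))" using x by simp
    moreover have "open (?B \<inter> \<psi> -` (- closure (\<psi> ` B')))"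
      by (rule continuous_open_preimage[OF cont open_ball open_Compl[OF closed_closure]])
    ultimately obtain r where r: "r > 0" "ball x r \<subseteq> ?B \<inter> \<psi> -` (- closure (\<psi> ` B'))"
      using open_contains_ball[of "?B \<inter> \<psi> -` (- closure (\<psi> ` B'))"] by blast
    let ?y = "x + (c * (r/2)) *\<^sub>R axis i 1"
    have "dist x ?y = r/2" using r(1) c by (simp add: dist_norm abs_mult)
    then have y: "?y \<in> ball x r" using r(1) by (simp only: mem_ball)
    have yB: "?y \<in> ?B" using subsetD[OF r(2) y] by (rule IntD1)
    have "0 < r/2" using r(1) by simp
    from B'[OF this yB] have "?y \<in> B'" .
    then have "\<psi> ?y \<in> closure (\<psi> ` B')" using closure_subset[of "\<psi> ` B'"] by (meson imageI subsetD)
    moreover have "?y \<in> \<psi> -` (- closure (\<psi> ` B'))" using subsetD[OF r(2) y] by (rule IntD2)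
    ultimately show False by simp
  qed
  have clos: "\<psi> x \<in> closure (\<psi> ` Bp) \<inter> closure (\<psi> ` Bm)" if x: "x \<in> ?B" "x $ i = 0" for x
    using near[OF x(1), of 1 Bp] near[OF x(1), of "-1" Bm] x(2) unfolding Bp_def Bm_def by simp
  have "crossing A (\<psi> ` ?B) (\<psi> ` Bp) (\<psi> ` Bm)"
    unfolding crossing_def
  proof (intro conjI)
    show "open (\<psi> ` ?B)" "open (\<psi> ` Bp)" "open (\<psi> ` Bm)"
      by (rule homeomorphism_open_image[OF h]; use op e(2) in \<open>auto simp: Bp_def Bm_def\<close>)+
    show "connected (\<psi> ` ?B)" "connected (\<psi> ` Bp)" "connected (\<psi> ` Bm)"
      using cv convex_connected continuous_on_subset[OF cont] unfolding Bp_def Bm_def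
      by (auto intro!: connected_continuous_image)
    show "\<psi> ` Bp \<inter> \<psi> ` Bm = {}" using inj unfolding Bp_def Bm_def by auto
    show "\<psi> ` ?B - A = \<psi> ` Bp \<union> \<psi> ` Bm" 
    proof -
      have "?B \<inter> {x. x $ i \<noteq> 0} = Bp \<union> Bm" unfolding Bp_def Bm_def by auto
      moreover have "\<psi> ` ?B - A = \<psi> ` (?B \<inter> {x. x $ i \<noteq> 0})" using inA by blast
      ultimately show ?thesis by (simp add: image_Un)
    qed
    have "\<psi> (\<phi> a) = a" using h(1) UV(1) by (auto simp: homeomorphism_def)
    then show "\<psi> ` ?B \<inter> A \<noteq> {}" using a e(1) by (metis centre_in_ball disjoint_iff imageI)
    show "\<psi> ` ?B \<inter> A \<subseteq> closure (\<psi> ` Bp) \<inter> closure (\<psi> ` Bm)" using clos inA by blast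
  qed
  moreover have "a \<in> \<psi> ` ?B" using h(1) UV(1) e(1) by (metis centre_in_ball homeomorphism_apply1 imageI)
  ultimately show ?thesis using e(3) by blast
qed

text \<open>A ball minus a half hyperplane whose edge passes through its centre is star-shaped with respect to a point on the
opposite half of the hyperplane.\<close>

lemma half_space_neighbourhood:
  fixes S :: "(real ^ 'n) set"
  assumes hs: "locally_half_space_along S B" and b: "b \<in> B" and N: "open N" "b \<in> N"
  shows "\<exists>G. open G \<and> b \<in> G \<and> G \<subseteq> N \<and> connected (G - S)"
proof -
  obtain U V \<phi> \<psi> and i j :: 'n where UV: "b \<in> U" "diffeomorphism U (V :: (real ^ 'n) set) \<phi> \<psi>" "i \<noteq> j"
    "\<phi> ` (U \<inter> S) = V \<inter> {x. x $ i = 0 \<and> 0 \<le> x $ j}" "\<phi> ` (U \<inter> B) = V \<inter> {x. x $ i = 0 \<and> x $ j = 0}"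
    using bspec[OF hs[unfolded locally_half_space_along_def] b] by (elim exE conjE) (rule that; assumption)
  have h: "homeomorphism U V \<phi> \<psi>" "open U" "open V" using UV(2) unfolding diffeomorphism_def by auto
  obtain e where e: "e > 0" "ball (\<phi> b) e \<subseteq> V" "\<psi> ` ball (\<phi> b) e \<subseteq> N"
    using coordinate_ball[OF h UV(1) N] .
  let ?B = "ball (\<phi> b) e" and ?H = "{x::real^'n. x $ i = 0 \<and> 0 \<le> x $ j}"
  have b0: "\<phi> b $ i = 0" "\<phi> b $ j = 0" using UV(1,5) b by blast+
  have \<phi>\<psi>: "\<phi> (\<psi> x) = x" "\<psi> x \<in> U" if "x \<in> ?B" for x using h(1) e(2) that by (auto simp: homeomorphism_def)
  have inS: "\<psi> x \<in> S \<longleftrightarrow> x \<in> ?H" if x: "x \<in> ?B" for x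
  proof
    assume "\<psi> x \<in> S"
    then have "\<phi> (\<psi> x) \<in> \<phi> ` (U \<inter> S)" using \<phi>\<psi>[OF x] by blast
    then show "x \<in> ?H" using UV(4) \<phi>\<psi>[OF x] by auto
  next
    assume "x \<in> ?H"
    then have "x \<in> \<phi> ` (U \<inter> S)" using UV(4) x e(2) by auto
    then show "\<psi> x \<in> S" using h(1) by (auto simp: homeomorphism_def)
  qed
  have cont: "continuous_on ?B \<psi>" using h(1) e(2) unfolding homeomorphism_def by (meson continuous_on_subset)
  \<comment> \<open>On the half of the hyperplane that is missing from the half space.\<close>
  define q where "q = \<phi> b - (e/2) *\<^sub>R axis j 1"
  have "dist (\<phi> b) q = e/2" using e(1) by (simp add: q_def dist_norm)
  then have qB: "q \<in> ?B" using e(1) by (simp only: mem_ball)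
  have qi: "q $ i = 0" and qj: "q $ j < 0" using b0 e(1) UV(3) by (auto simp: q_def axis_def)
  have "starlike (?B - ?H)"
    unfolding starlike_def
  proof (intro bexI ballI)
    show "q \<in> ?B - ?H" using qB qj by auto
    fix x assume x: "x \<in> ?B - ?H"
    have "closed_segment q x \<subseteq> ?B" using qB x by (intro closed_segment_subset) auto
    moreover have "y \<notin> ?H" if y: "y \<in> closed_segment q x" for y
    proof
      assume yH: "y \<in> ?H"
      obtain t where t: "0 \<le> t" "t \<le> 1" "y = (1 - t) *\<^sub>R q + t *\<^sub>R x" using y unfolding closed_segment_def by blast
      have yi: "t * x $ i = 0" and yj: "0 \<le> (1 - t) * q $ j + t * x $ j" using yH t qi by auto
      have "t \<noteq> 0" using yj qj by auto
      then have "x $ i = 0" using yi by simp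
      then have "x $ j < 0" using x by auto
      then have "(1 - t) * q $ j \<le> 0" "t * x $ j < 0" using qj t \<open>t \<noteq> 0\<close>
        by (auto simp: mult_nonneg_nonpos mult_pos_neg)
      then show False using yj by linarith
    qed
    ultimately show "closed_segment q x \<subseteq> ?B - ?H" by blast
  qed
  then have "connected (?B - ?H)" by (rule starlike_imp_connected)
  then have "connected (\<psi> ` (?B - ?H))" by (intro connected_continuous_image continuous_on_subset[OF cont]) auto
  also have "\<psi> ` (?B - ?H) = \<psi> ` ?B - S" using inS by blast
  finally have "connected (\<psi> ` ?B - S)" .
  moreover have "open (\<psi> ` ?B)" using homeomorphism_open_image[OF h open_ball e(2)] .
  moreover have "b \<in> \<psi> ` ?B" using h(1) UV(1) e(1) by (metis centre_in_ball homeomorphism_apply1 imageI)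
  ultimately show ?thesis using e(3) by blast
qed

text \<open>The union of all lines through \<open>x\<close> and a point of \<open>S\<close>.\<close>

definition cone :: "'a::real_vector \<Rightarrow> 'a set \<Rightarrow> 'a set" where
  "cone x S = {x + t *\<^sub>R (m - x) | m t. m \<in> S}"

text \<open>Locally the cone is the image of a hyperplane piece under a differentiable map, because a coordinate that vanishes on
the submanifold is free to serve as the parameter on the line, and a second one still vanishes.\<close>

lemma negligible_cone_over_submanifold:
  fixes S :: "(real ^ 'n) set"
  assumes S: "submanifold_codim k S" and k: "2 \<le> k"
  shows "negligible (cone x S)"
proof -
  have loc: "\<exists>U. open U \<and> a \<in> U \<and> negligible (cone x (U \<inter> S))" if a: "a \<in> S" for a
  proof -
    obtain U V \<phi> \<psi> and I :: "'n set" where UV: "a \<in> U" "diffeomorphism U (V :: (real ^ 'n) set) \<phi> \<psi>" "card I = k"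
      "\<phi> ` (U \<inter> S) = V \<inter> {x. \<forall>i\<in>I. x $ i = 0}"
      using bspec[OF S[unfolded submanifold_codim_def] a] by (elim exE conjE) (rule that; assumption)
    have h: "homeomorphism U V \<phi> \<psi>" "open U" "open V" "smooth_on \<psi> V" using UV(2) unfolding diffeomorphism_def by auto
    have "\<not> card I \<le> 1" using k UV(3) by simp
    then obtain i j where ij: "i \<in> I" "j \<in> I" "i \<noteq> j" using card_le_Suc0_iff_eq[of I] by (auto simp: finite)
    define flat where "flat v = v - (v $ j) *\<^sub>R axis j 1" for v :: "real ^ 'n"
    \<comment> \<open>The coordinate \<open>j\<close> becomes the parameter on the line, while \<open>i\<close> stays zero.\<close>
    define f where "f v = x + (v $ j) *\<^sub>R (\<psi> (flat v) - x)" for v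
    define L where "L = {v. v $ i = 0 \<and> flat v \<in> V}"
    have neg: "negligible L" by (rule negligible_subset[OF negligible_standard_hyperplane_cart[of i]]) (auto simp: L_def)
    have "f differentiable (at v)" if v: "v \<in> L" for v
    proof -
      have "Ck_on (Suc 0) \<psi> V" using h(4) unfolding smooth_on_def by blast
      then have \<psi>: "\<psi> differentiable (at (flat v))" using v unfolding L_def by simp
      have comp: "(\<lambda>v::real^'n. v $ j) differentiable (at v)"
        by (intro bounded_linear_imp_differentiable bounded_linear_vec_nth)
      have "flat differentiable (at v)" unfolding flat_def by (intro derivative_intros comp)
      then have "(\<lambda>v. \<psi> (flat v)) differentiable (at v)"
        using differentiable_chain_at[of flat v \<psi>] \<psi> by (simp add: o_def)
      then show ?thesis unfolding f_def using comp by (intro derivative_intros) auto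
    qed
    then have "f differentiable_on L" unfolding differentiable_on_def by (blast intro: differentiable_at_withinI)
    then have "negligible (f ` L)" using negligible_differentiable_image_negligible[OF order_refl neg] by blast
    moreover have "cone x (U \<inter> S) \<subseteq> f ` L"
    proof
      fix z assume "z \<in> cone x (U \<inter> S)"
      then obtain m t where m: "m \<in> U" "m \<in> S" "z = x + t *\<^sub>R (m - x)" unfolding cone_def by blast
      have y: "\<phi> m \<in> V" "\<phi> m $ i = 0" "\<phi> m $ j = 0" using UV(4) m ij by blast+
      let ?v = "\<phi> m + t *\<^sub>R axis j 1"
      have vj: "?v $ j = t" and vi: "?v $ i = 0" using y ij(3) by (auto simp: axis_def)
      have fl: "flat ?v = \<phi> m" unfolding flat_def vj by simp
      have "?v \<in> L" unfolding L_def using vi fl y(1) by simp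
      moreover have "\<psi> (\<phi> m) = m" using h(1) m(1) by (auto simp: homeomorphism_def)
      then have "f ?v = z" unfolding f_def fl vj using m(3) by simp
      ultimately show "z \<in> f ` L" by blast
    qed
    ultimately have "negligible (cone x (U \<inter> S))" using negligible_subset by blast
    then show ?thesis using h(2) UV(1) by blast
  qed
  define \<U> where "\<U> = {U. open U \<and> negligible (cone x (U \<inter> S))}"
  obtain \<V> where \<V>: "\<V> \<subseteq> \<U>" "countable \<V>" "\<Union>\<V> = \<Union>\<U>"
    using Lindelof[of \<U>] unfolding \<U>_def by blast
  have "S \<subseteq> \<Union>\<V>" using loc unfolding \<V>(3) \<U>_def by blast
  then have "cone x S \<subseteq> \<Union>((\<lambda>U. cone x (U \<inter> S)) ` \<V>)" unfolding cone_def by blast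
  moreover have "negligible (\<Union>((\<lambda>U. cone x (U \<inter> S)) ` \<V>))"
    using \<V>(1,2) unfolding \<U>_def by (intro negligible_countable_Union) auto
  ultimately show ?thesis using negligible_subset by blast
qed

lemma negligible_cone:
  fixes S :: "(real ^ 'n) set"
  assumes "codim_at_least 2 S"
  shows "negligible (cone x S)"
proof -
  obtain \<M> where M: "countable \<M>" "\<forall>M\<in>\<M>. \<exists>k\<ge>2. submanifold_codim k M" "S \<subseteq> \<Union>\<M>"
    using assms unfolding codim_at_least_def by blast
  have "cone x S \<subseteq> \<Union>(cone x ` \<M>)" using M(3) unfolding cone_def by blast
  moreover have "negligible (\<Union>(cone x ` \<M>))"
    using M(1,2) negligible_cone_over_submanifold by (intro negligible_countable_Union) blast+
  ultimately show ?thesis using negligible_subset by blast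
qed

text \<open>Almost every point of the convex set can be joined by segments avoiding \<open>S\<close> to both of two given
points, since the bad ones lie on two null cones.\<close>

lemma connected_convex_diff_codim_2:
  fixes S :: "(real ^ 'n) set"
  assumes S: "codim_at_least 2 S" and B: "open B" "convex B"
  shows "connected (B - S)"
  unfolding connected_iff_connected_component
proof (intro ballI)
  fix x y assume x: "x \<in> B - S" and y: "y \<in> B - S"
  have "\<not> negligible B" using open_not_negligible[OF B(1)] x by blast
  moreover have "negligible (cone x S \<union> cone y S)" using negligible_cone[OF S] by (simp add: negligible_Un)
  ultimately obtain z where z: "z \<in> B" "z \<notin> cone x S" "z \<notin> cone y S" using negligible_subset by blast
  have seg: "connected_component (B - S) w z" if w: "w \<in> B - S" "z \<notin> cone w S" for w
  proof -
    have "m \<notin> S" if m: "m \<in> closed_segment w z" for m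
    proof
      assume "m \<in> S"
      obtain t where t: "0 \<le> t" "m = (1 - t) *\<^sub>R w + t *\<^sub>R z" using m unfolding closed_segment_def by blast
      have "t \<noteq> 0" using t w \<open>m \<in> S\<close> by auto
      moreover have "m - w = t *\<^sub>R (z - w)" using t(2) by (simp add: algebra_simps)
      ultimately have "z = w + (1/t) *\<^sub>R (m - w)" by simp
      then show False using w(2) \<open>m \<in> S\<close> unfolding cone_def by blast
    qed
    moreover have "closed_segment w z \<subseteq> B" using B(2) w(1) z(1) by (intro closed_segment_subset) auto
    ultimately have "closed_segment w z \<subseteq> B - S" by blast
    then show ?thesis unfolding connected_component_def by (intro exI[of _ "closed_segment w z"]) auto
  qed
  show "connected_component (B - S) x y"
    using seg[OF x z(2)] seg[OF y z(3)] connected_component_trans connected_component_sym by metis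
qed

text \<open>Being joined by a connected part of the complement is a transitive relation, and it holds between any two
points of the complement that are close to the same point of \<open>X\<close>.\<close>

lemma connected_diff_locally:
  assumes X: "connected X"
    and dense: "\<And>T. openin (top_of_set X) T \<Longrightarrow> T \<noteq> {} \<Longrightarrow> T - Z \<noteq> {}"
    and local: "\<And>x. x \<in> X \<Longrightarrow> \<exists>U. openin (top_of_set X) U \<and> x \<in> U \<and> connected (U - Z)"
  shows "connected (X - Z)"
  unfolding connected_iff_connected_component
proof (intro ballI)
  fix x y assume x: "x \<in> X - Z" and y: "y \<in> X - Z"
  show "connected_component (X - Z) x y"
  proof (rule connected_equivalence_relation_gen[OF X, of x y "\<lambda>z. z \<notin> Z"])
    show "\<exists>z. z \<in> T \<and> z \<notin> Z" if "openin (top_of_set X) T" "a \<in> T" for T a using dense[OF that(1)] that(2) by blast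
    fix a assume "a \<in> X"
    then obtain U where U: "openin (top_of_set X) U" "a \<in> U" "connected (U - Z)" using local by blast
    have "U - Z \<subseteq> X - Z" using U(1) openin_imp_subset by blast
    then have "\<forall>x\<in>U. \<forall>y\<in>U. x \<notin> Z \<and> y \<notin> Z \<longrightarrow> connected_component (X - Z) x y"
      using U(3) unfolding connected_component_def by blast
    then show "\<exists>T. openin (top_of_set X) T \<and> a \<in> T \<and> (\<forall>x\<in>T. \<forall>y\<in>T. x \<notin> Z \<and> y \<notin> Z \<longrightarrow> connected_component (X - Z) x y)"
      using U by blast
  qed (use x y connected_component_trans in auto)
qed

lemma local_diffeomorphism_section:
  assumes F: "local_diffeomorphism X \<A> F" and w: "w \<in> X" and T: "openin (top_of_set X) T" "w \<in> T"
  obtains e G where "e > 0" "homeomorphism (G ` ball (F w) e) (ball (F w) e) F G"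
    "openin (top_of_set X) (G ` ball (F w) e)" "G ` ball (F w) e \<subseteq> T" "G (F w) = w"
proof -
  obtain U G where U: "openin (top_of_set X) U" "w \<in> U" "open (F ` U)" "homeomorphism U (F ` U) F G"
    using F w unfolding local_diffeomorphism_def by blast
  have "openin (top_of_set U) (U \<inter> T)"
    using U(1) T(1) by (metis openin_Int openin_subset_trans inf_le1 openin_imp_subset)
  then have "openin (top_of_set (F ` U)) (F ` (U \<inter> T))"
    using homeomorphism_imp_open_map[OF U(4)] by blast
  then have "open (F ` (U \<inter> T))" using U(3) openin_open_eq by blast
  moreover have "F w \<in> F ` (U \<inter> T)" using U(2) T(2) by blast
  ultimately obtain e where e: "e > 0" "ball (F w) e \<subseteq> F ` (U \<inter> T)" using open_contains_ball by blast
  have GB: "G ` ball (F w) e \<subseteq> U \<inter> T"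
  proof
    fix z assume "z \<in> G ` ball (F w) e"
    then obtain y where "y \<in> ball (F w) e" "z = G y" by blast
    then obtain v where "v \<in> U \<inter> T" "z = G (F v)" using e(2) by blast
    then show "z \<in> U \<inter> T" using homeomorphism_apply1[OF U(4), of v] by simp
  qed
  have hom: "homeomorphism (G ` ball (F w) e) (ball (F w) e) F G"
  proof (rule homeomorphism_of_subsets[OF U(4)])
    have "F (G y) = y" if "y \<in> ball (F w) e" for y
      using homeomorphism_apply2[OF U(4)] e(2) that by blast
    then show "F ` G ` ball (F w) e = ball (F w) e" by (simp add: image_image)
  qed (use GB e in auto)
  have "openin (top_of_set (F ` U)) (ball (F w) e)" using e(2) by (intro open_subset) auto
  then have "openin (top_of_set U) (G ` ball (F w) e)"
    using homeomorphism_imp_open_map[OF homeomorphism_symD[OF U(4)]] by blast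
  then have "openin (top_of_set X) (G ` ball (F w) e)" using U(1) by (rule openin_trans)
  then show ?thesis using that[OF e(1) hom] GB homeomorphism_apply1[OF U(4) U(2)] by blast
qed

lemma connected_preimage_complement:
  fixes F :: "'x::topological_space \<Rightarrow> real ^ 'n"
  assumes F: "local_diffeomorphism X \<A> F" and X: "connected X"
    and D: "codim_at_least 2 D" and int: "\<And>B. open B \<Longrightarrow> B \<noteq> {} \<Longrightarrow> B - D \<noteq> {}"
  shows "connected (X - F -` D)"
proof (rule connected_diff_locally[OF X])
  fix T assume T: "openin (top_of_set X) T" "T \<noteq> {}"
  then obtain w where w: "w \<in> T" by blast
  have "w \<in> X" using w T openin_imp_subset by blast
  obtain e G where G: "e > 0" "homeomorphism (G ` ball (F w) e) (ball (F w) e) F G" "G ` ball (F w) e \<subseteq> T"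
    using local_diffeomorphism_section[OF F \<open>w \<in> X\<close> T(1) w] by metis
  have "ball (F w) e - D \<noteq> {}" using G(1) by (intro int) auto
  then obtain y where y: "y \<in> ball (F w) e" "y \<notin> D" by blast
  then have "G y \<in> T - F -` D" using G(3) homeomorphism_apply2[OF G(2) y(1)] by auto
  then show "T - F -` D \<noteq> {}" by blast
next
  fix w assume w: "w \<in> X"
  obtain e G where G: "e > 0" "homeomorphism (G ` ball (F w) e) (ball (F w) e) F G"
    "openin (top_of_set X) (G ` ball (F w) e)" "G (F w) = w"
    using local_diffeomorphism_section[OF F w openin_subtopology_self w] by metis
  have eq: "G ` ball (F w) e - F -` D = G ` (ball (F w) e - D)"
    using homeomorphism_apply2[OF G(2)] by auto
  have "connected (G ` (ball (F w) e - D))"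
    using connected_convex_diff_codim_2[OF D, of "ball (F w) e"] G(2)
    by (intro connected_continuous_image) (auto simp: homeomorphism_def intro: continuous_on_subset)
  moreover have "w \<in> G ` ball (F w) e" using G(1,4) by (metis centre_in_ball imageI)
  ultimately show "\<exists>U. openin (top_of_set X) U \<and> w \<in> U \<and> connected (U - F -` D)"
    using G(3) eq by metis
qed

text \<open>Here \<open>A\<close> does not separate \<open>G \<inter> M\<close>, so a section there lies on one sheet on both sides of any crossing
inside.\<close>

lemma (in cut_covering) fixed_sheet:
  assumes g: "is_section W p (G \<inter> M) g" and G: "open G" "connected (G \<inter> M - A)" and a: "a \<in> G" "a \<in> A"
  obtains V P Q w where "covered_crossing V P Q" "(w,w) \<in> monodromy V P Q"
proof -
  have "open (G \<inter> M)" "a \<in> G \<inter> M" using G(1) open_M a A_sub by auto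
  then obtain V P Q where V: "covered_crossing V P Q" "V \<subseteq> G \<inter> M" using covered_crossing_exists[OF a(2)] by blast
  note cs = covered_crossing_sides[OF V(1)]
  have sub: "P \<subseteq> G \<inter> M - A" "Q \<subseteq> G \<inter> M - A" using V(2) cs by blast+
  obtain w where w: "w \<in> fibre" "\<And>y. y \<in> G \<inter> M - A \<Longrightarrow> g y = sheet w y"
    using section_on_side[OF g _ _ _ G(2)] sub(1) cs(5) by blast
  have "(w,w) \<in> monodromy V P Q"
    unfolding monodromy_def using w sub is_lift_subset[OF g V(2)] by blast
  then show ?thesis using that V(1) by blast
qed

section \<open>The sheet number\<close>

theorem theorem1p5:
  fixes X :: "'x::topological_space set"
    and \<A> :: "('x set \<times> ('x \<Rightarrow> 'm::euclidean_space)) set"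
    and F :: "'x \<Rightarrow> real ^ 'n"
    and A D :: "(real ^ 'n) set"
    and d :: enat
  assumes "smooth_manifold X \<A>"
    and "connected X"
    and "trivial_group (homology_group 1 (top_of_set X))"
    and "local_diffeomorphism X \<A> F"
    and "closed D"
    and "0 < d"
    and "sheeted_covering d (X - F -` D) F (UNIV - D)"
    and "submanifold_codim 1 A"
    and "connected A"
    and "nicely_bounds A D"
    and "simply_connected (UNIV - closure A)"
  shows "d = 1 \<or> d = 2 \<or> d = \<infinity>"
proof (cases d)
  case infinity
  then show ?thesis by simp
next
  case (enat k)
  define M where "M = UNIV - D"
  define W where "W = X - F -` D"
  have cov: "covering_space W F M"
    using assms(7) unfolding sheeted_covering_def M_def W_def by blast
  have D: "D = closure A - A"
    and comp: "\<And>C. C \<in> components (closure A) \<Longrightarrow> \<exists>!K. K \<in> components D \<and> K \<subseteq> C"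
    using assms(10) unfolding nicely_bounds_def by blast+
  obtain D\<^sub>0 where D\<^sub>0: "submanifold_codim 2 D\<^sub>0" "D = closure D\<^sub>0" "codim_at_least 4 (D - D\<^sub>0)"
    "locally_half_space_along (closure A) D\<^sub>0"
    using assms(10) unfolding nicely_bounds_def by blast
  have AM: "A \<subseteq> M" using D unfolding M_def by blast
  have cut: "M - A = UNIV - closure A" using D closure_subset[of A] unfolding M_def by blast
  have cross: "\<exists>V P Q. crossing A V P Q \<and> a \<in> V \<and> V \<subseteq> N" if "a \<in> A" "open N" "a \<in> N" for a N
    using hypersurface_crossing[OF assms(8)] that by blast
  have openM: "open M" unfolding M_def using assms(5) by (simp add: open_Diff)
  \<comment> \<open>A base point for the sheets.\<close>
  have "M - A \<noteq> {}"
  proof (cases "A = {}")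
    case True
    then show ?thesis using cut by simp
  next
    case False
    then obtain a where a: "a \<in> A" by blast
    then obtain V P Q where V: "crossing A V P Q" "V \<subseteq> M" using cross[OF a openM] AM by blast
    then have "P \<noteq> {}" "P \<subseteq> V - A" using crossing_nonempty[OF V(1)] unfolding crossing_def by auto
    then show ?thesis using V(2) by blast
  qed
  then obtain x0 where x0: "x0 \<in> M - A" by blast
  interpret C: cut_covering W F M A x0
  proof
    show "open (M - A)" unfolding cut by (simp add: open_Diff)
    show "simply_connected (M - A)" unfolding cut by (rule assms(11))
  qed (fact cov openM AM x0 cross)+
  have k: "card C.fibre = k" "finite C.fibre" "k > 0"
  proof -
    have "x0 \<in> UNIV - D" using x0 unfolding M_def by blast
    with assms(7) have "(if finite {x \<in> X - F -` D. F x = x0} then enat (card {x \<in> X - F -` D. F x = x0}) else \<infinity>) = d"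
      unfolding sheeted_covering_def by blast
    then have "(if finite C.fibre then enat (card C.fibre) else \<infinity>) = enat k"
      unfolding C.fibre_def W_def[symmetric] enat .
    then show "card C.fibre = k" "finite C.fibre" by (auto split: if_splits)
    show "k > 0" using assms(6) enat by (simp add: zero_enat_def)
  qed
  then have ne: "C.fibre \<noteq> {}" by auto
  have codim: "codim_at_least 2 D"
  proof -
    obtain \<M> where \<M>: "countable \<M>" "\<forall>N\<in>\<M>. \<exists>k\<ge>4. submanifold_codim k N" "D - D\<^sub>0 \<subseteq> \<Union>\<M>"
      using D\<^sub>0(3) unfolding codim_at_least_def by blast
    have "\<exists>k\<ge>2. submanifold_codim k N" if N: "N \<in> insert D\<^sub>0 \<M>" for N
    proof (cases "N = D\<^sub>0")
      case True
      then show ?thesis using D\<^sub>0(1) by blast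
    next
      case False
      then obtain k where "k \<ge> 4" "submanifold_codim k N" using \<M>(2) N by blast
      then show ?thesis by (intro exI[of _ k]) auto
    qed
    then show ?thesis
      unfolding codim_at_least_def using \<M>(1,3) by (intro exI[of _ "insert D\<^sub>0 \<M>"]) auto
  qed
  have W: "connected W"
    unfolding W_def
  proof (rule connected_preimage_complement[OF assms(4,2) codim])
    fix B :: "(real ^ 'n) set" assume B: "open B" "B \<noteq> {}"
    show "B - D \<noteq> {}"
    proof
      assume "B - D = {}"
      then have "B \<inter> closure A \<noteq> {}" "B \<inter> A = {}" using B(2) D by blast+
      then show False using open_Int_closure_eq_empty[OF B(1)] by blast
    qed
  qed
  have "k \<le> 2"
  proof (cases "A = {}")
    case True
    obtain w where "w \<in> C.fibre" using ne by blast
    then have "C.fibre = {w}" using C.one_sheet_if_uncut[OF W True] by blast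
    then show ?thesis using k(1) by simp
  next
    case False
    \<comment> \<open>As \<open>closure A\<close> is connected and nonempty, it contains a component of \<open>D\<close>.\<close>
    have "closure A \<in> components (closure A)"
      using False assms(9) by (simp add: connected_imp_connected_closure in_components_self)
    then have "D \<noteq> {}" using comp[of "closure A"] in_components_nonempty in_components_subset by blast
    then have M: "M \<noteq> UNIV" unfolding M_def by blast
    show ?thesis
    proof (cases "W = X")
      case True
      obtain a where "a \<in> A" using False by blast
      then obtain V P Q where "C.covered_crossing V P Q" using C.covered_crossing_exists[of a UNIV] by blast
      then show ?thesis
        using C.at_most_two_sheets_if_symmetric[OF W assms(9)] C.symmetric_if_trivial_homology[OF _ k(2) ne assms(9) M]
          assms(3) True k(1) by metis
    next
      case False
      then obtain q where q: "q \<in> X" "F q \<in> D" unfolding W_def by blast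
      obtain e g where g: "e > 0" "homeomorphism (g ` ball (F q) e) (ball (F q) e) F g"
        "g ` ball (F q) e \<subseteq> X"
        using local_diffeomorphism_section[OF assms(4) q(1) openin_subtopology_self q(1)] by metis
      have "F q \<in> closure D\<^sub>0" using q(2) D\<^sub>0(2) by simp
      then obtain b where b: "b \<in> D\<^sub>0" "b \<in> ball (F q) e"
        using g(1) by (metis closure_approachable dist_commute mem_ball)
      obtain G where G: "open G" "b \<in> G" "G \<subseteq> ball (F q) e" "connected (G - closure A)"
        using half_space_neighbourhood[OF D\<^sub>0(4) b(1) open_ball b(2)] by blast
      have "b \<in> D" using b(1) D\<^sub>0(2) closure_subset by blast
      then have "G \<inter> closure A \<noteq> {}" using G(2) D by blast
      then obtain a where a: "a \<in> G" "a \<in> A" using open_Int_closure_eq_empty[OF G(1)] by blast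
      have Fg: "F (g y) = y" if "y \<in> G" for y using homeomorphism_apply2[OF g(2)] G(3) that by blast
      have "is_section W F (G \<inter> M) g"
        unfolding is_lift_def
      proof (intro conjI ballI)
        show "continuous_on (G \<inter> M) g"
          using g(2) G(3) unfolding homeomorphism_def by (meson continuous_on_subset le_infI1)
        show "g ` (G \<inter> M) \<subseteq> W" using g(3) G(3) Fg unfolding W_def M_def by auto
      qed (use Fg in auto)
      moreover have "G \<inter> M - A = G - closure A" using cut by blast
      ultimately obtain V P Q w where "C.covered_crossing V P Q" "(w,w) \<in> C.monodromy V P Q"
        using C.fixed_sheet[OF _ G(1) _ a] G(4) by metis
      then have "C.fibre = {w}" using C.one_sheet_if_fixed[OF W assms(9)] by blast
      then show ?thesis using k(1) by simp
    qed
  qed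
  then have "k = 1 \<or> k = 2" using k(3) by linarith
  then show ?thesis using enat by (auto simp: one_enat_def numeral_eq_enat)
qed


end
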